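(* Let $d\ge 1$, $r,\sigma>0$ and $c=r\sigma$. Let $v\in L^2(\mathbb{R}^d)$ with $\operatorname{supp} v\subset B_\sigma$. Then the Fourier transform $\hat v$ restricted to $B_r$ determines $v$ via the following formulas: $$v(q)=\mathcal{R}^{-1}[f_{r,\sigma}](\sigma^{-1}q),\qquad q\in\mathbb{R}^d,$$ $$f_{r,\sigma}(y,\theta):=\begin{cases}\mathcal{F}_c^{-1}[g_{r,\theta}](y), & \text{if } y\in[-1,1],\\ 0,&\text{otherwise},\end{cases}$$ $$g_{r,\theta}(x):=\left(\frac{2\pi}{\sigma}\right)^d\hat v(rx\theta),\qquad x\in[-1,1],\ \theta\in\mathbb{S}^{d-1},$$ where $\mathcal{F}_c^{-1}$ is the inverse (given by its series in prolate spheroidal wave functions) of the operator $\mathcal{F}_c$ and $\mathcal{R}^{-1}$ is the inverse Radon transform.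
   Context: $B_\rho:=\{q\in\mathbb{R}^d: |q|<\rho\}$ for $\rho>0$. Functions are complex-valued; equalities of $L^2$ functions are understood almost everywhere. Fourier transform: $\hat v(p):=\frac{1}{(2\pi)^d}\int_{\mathbb{R}^d}e^{ipq}v(q)\,dq$, $p\in\mathbb{R}^d$, where $pq$ is the scalar product. For $c>0$, the compact operator $\mathcal{F}_c$ on $L^2([-1,1])$ is $\mathcal{F}_c[f](x):=\int_{-1}^1e^{icxy}f(y)\,dy$. Let $\mathbb{N}=\{0,1,\ldots\}$. Its eigenfunctions $(\psi_{j,c})_{j\in\mathbb{N}}$ (prolate spheroidal wave functions) are real-valued and form an orthonormal basis of $L^2([-1,1])$; the corresponding eigenvalues $(\mu_{j,c})_{j\in\mathbb{N}}$ are simple and non-zero, and are ordered so that $0<|\mu_{j+1,c}|<|\mu_{j,c}|$ for all $j\in\mathbb{N}$. The inverse of $\mathcal{F}_c$ on its range is $\mathcal{F}_c^{-1}[g](y)=\sum_{j\in\mathbb{N}}\frac{1}{\mu_{j,c}}\psi_{j,c}(y)\int_{-1}^1\psi_{j,c}(x)g(x)\,dx$. Inverse Radon transform (for $u$ on $\mathbb{R}\times\mathbb{S}^{d-1}$ with $u(t,\theta)=u(-t,-\theta)$): $$\mathcal{R}^{-1}[u](q):=\frac{1}{(2\pi)^{d-1}}\int_{\mathbb{S}^{d-1}}\int_0^{+\infty}e^{-is\theta q}\hat u(s,\theta)s^{d-1}\,ds\,d\theta,\quad q\in\mathbb{R}^d,\qquad \hat u(s,\theta):=\frac{1}{2\pi}\int_{\mathbb{R}}e^{ist}u(t,\theta)\,dt.$$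 The first formula is the inverse Fourier transform of $p\mapsto(2\pi)^{1-d}\hat u(|p|,p/|p|)$ written in polar coordinates, and is understood in the $L^2$/tempered distribution sense when the integral does not converge absolutely. For $d=1$, $\mathbb{S}^0=\{-1,1\}$ with counting measure. *)

theory Defs
  imports "HOL-Analysis.Analysis"
begin

section \<open>Square-integrable complex functions\<close>

definition L2 :: "'a measure \<Rightarrow> ('a \<Rightarrow> complex) set" where
  "L2 M = {f \<in> borel_measurable M. integrable M (\<lambda>x. (cmod (f x))\<^sup>2)}"

definition L2_tendsto :: "'a measure \<Rightarrow> ('i \<Rightarrow> 'a \<Rightarrow> complex) \<Rightarrow> ('a \<Rightarrow> complex) \<Rightarrow> 'i filter \<Rightarrow> bool" where
  "L2_tendsto M u f F \<longleftrightarrow>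
     f \<in> L2 M \<and> (\<forall>\<^sub>F i in F. u i \<in> L2 M) \<and>
     ((\<lambda>i. LINT x|M. (cmod (u i x - f x))\<^sup>2) \<longlongrightarrow> 0) F"

text \<open>
  The limit is only determined up to a null set; \<open>L2_lim\<close> selects a representative. Its value is
  meaningful only when the limit exists, i.e. when \<open>L2_tendsto M u (L2_lim M u F) F\<close>.
\<close>

definition L2_lim :: "'a measure \<Rightarrow> ('i \<Rightarrow> 'a \<Rightarrow> complex) \<Rightarrow> 'i filter \<Rightarrow> 'a \<Rightarrow> complex" where
  "L2_lim M u F = (SOME f. L2_tendsto M u f F)"

text \<open>The support of a function considered up to null sets.\<close>

definition ess_support :: "('a::euclidean_space \<Rightarrow> complex) \<Rightarrow> 'a set" where
  "ess_support v =
     {x. \<forall>U. open U \<and> x \<in> U \<longrightarrow> \<not> (AE y in lebesgue. y \<in> U \<longrightarrow> v y = 0)}"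

definition fourier :: "('a::euclidean_space \<Rightarrow> complex) \<Rightarrow> 'a \<Rightarrow> complex" where
  "fourier v p =
     complex_of_real (1 / (2 * pi) ^ DIM('a)) *
     (LINT q|lebesgue. exp (\<i> * complex_of_real (p \<bullet> q)) * v q)"


section \<open>Prolate spheroidal wave functions\<close>

abbreviation leb_I :: "real measure" where
  "leb_I \<equiv> lebesgue_on {-1..1}"

definition prolate_op :: "real \<Rightarrow> (real \<Rightarrow> complex) \<Rightarrow> real \<Rightarrow> complex" where
  "prolate_op c f x = (LINT y|leb_I. exp (\<i> * complex_of_real (c * x * y)) * f y)"

text \<open>
  The wave functions are unique only up to sign (and null sets), so they are described by a
  predicate rather than chosen. The last two clauses imply that the eigenvalues are non-zero and
  simple and that every eigenvalue of the operator on \<open>L\<^sup>2([-1,1])\<close> is some \<open>\<mu> j\<close>.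
\<close>

definition prolate_system :: "real \<Rightarrow> (nat \<Rightarrow> real \<Rightarrow> real) \<Rightarrow> (nat \<Rightarrow> complex) \<Rightarrow> bool" where
  "prolate_system c \<psi> \<mu> \<longleftrightarrow>
     (\<forall>j. (\<lambda>x. complex_of_real (\<psi> j x)) \<in> L2 leb_I) \<and>
     (\<forall>j. AE x in leb_I. prolate_op c (\<lambda>y. complex_of_real (\<psi> j y)) x = \<mu> j * complex_of_real (\<psi> j x)) \<and>
     (\<forall>j k. (LINT x|leb_I. \<psi> j x * \<psi> k x) = (if j = k then 1 else 0)) \<and>
     (\<forall>f \<in> L2 leb_I.
        L2_tendsto leb_I
          (\<lambda>n y. \<Sum>j<n. complex_of_real (\<psi> j y) * (LINT x|leb_I. complex_of_real (\<psi> j x) * f x))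
          f sequentially) \<and>
     (\<forall>j. 0 < cmod (\<mu> (Suc j)) \<and> cmod (\<mu> (Suc j)) < cmod (\<mu> j))"

definition prolate_inv_partial ::
    "(nat \<Rightarrow> real \<Rightarrow> real) \<Rightarrow> (nat \<Rightarrow> complex) \<Rightarrow> (real \<Rightarrow> complex) \<Rightarrow> nat \<Rightarrow> real \<Rightarrow> complex" where
  "prolate_inv_partial \<psi> \<mu> g n y =
     (\<Sum>j<n. 1 / \<mu> j * complex_of_real (\<psi> j y) * (LINT x|leb_I. complex_of_real (\<psi> j x) * g x))"

definition prolate_inv ::
    "(nat \<Rightarrow> real \<Rightarrow> real) \<Rightarrow> (nat \<Rightarrow> complex) \<Rightarrow> (real \<Rightarrow> complex) \<Rightarrow> real \<Rightarrow> complex" where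
  "prolate_inv \<psi> \<mu> g = L2_lim leb_I (prolate_inv_partial \<psi> \<mu> g) sequentially"


section \<open>Inverse Radon transform\<close>

text \<open>
  Surface measure on the unit sphere, normalised by polar coordinates: the measure of \<open>A\<close> is \<open>d\<close>
  times the volume of the cone over \<open>A\<close> inside the unit ball. For \<open>d = 1\<close> it is counting measure
  on \<open>{-1, 1}\<close>.
\<close>

definition sphere_measure :: "'a::euclidean_space measure" where
  "sphere_measure =
     scale_measure (of_nat DIM('a))
       (distr (restrict_space lborel (ball 0 1 - {0})) (restrict_space borel (sphere 0 1)) sgn)"

definition radon_fourier :: "(real \<Rightarrow> 'a \<Rightarrow> complex) \<Rightarrow> real \<Rightarrow> 'a \<Rightarrow> complex" where
  "radon_fourier u s \<theta> =
     complex_of_real (1 / (2 * pi)) * (LINT t|lebesgue. exp (\<i> * complex_of_real (s * t)) * u t \<theta>)"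

text \<open>
  The radial integral is cut off at \<open>R\<close>, which truncates the inverse Fourier integral to the ball
  of radius \<open>R\<close>; the transform itself is the limit in \<open>L\<^sup>2\<close> as \<open>R\<close> tends to infinity.
\<close>

definition inv_radon_trunc :: "(real \<Rightarrow> 'a::euclidean_space \<Rightarrow> complex) \<Rightarrow> real \<Rightarrow> 'a \<Rightarrow> complex" where
  "inv_radon_trunc u R q =
     complex_of_real (1 / (2 * pi) ^ (DIM('a) - 1)) *
     (LINT \<theta>|sphere_measure. LINT s|lebesgue_on {0..R}.
        exp (- \<i> * complex_of_real (s * (\<theta> \<bullet> q))) * radon_fourier u s \<theta> *
        complex_of_real (s ^ (DIM('a) - 1)))"

definition inv_radon :: "(real \<Rightarrow> 'a::euclidean_space \<Rightarrow> complex) \<Rightarrow> 'a \<Rightarrow> complex" where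
  "inv_radon u = L2_lim lebesgue (inv_radon_trunc u) at_top"


section \<open>Reconstruction from band-limited data\<close>

text \<open>
  In the following, \<open>w\<close> is the data, known to equal the Fourier transform of \<open>v\<close> on the ball of
  radius \<open>r\<close>.
\<close>

definition slice_data :: "real \<Rightarrow> real \<Rightarrow> ('a::euclidean_space \<Rightarrow> complex) \<Rightarrow> 'a \<Rightarrow> real \<Rightarrow> complex" where
  "slice_data r \<sigma> w \<theta> x = complex_of_real ((2 * pi / \<sigma>) ^ DIM('a)) * w ((r * x) *\<^sub>R \<theta>)"

definition radon_data ::
    "(nat \<Rightarrow> real \<Rightarrow> real) \<Rightarrow> (nat \<Rightarrow> complex) \<Rightarrow> real \<Rightarrow> real \<Rightarrow>
     ('a::euclidean_space \<Rightarrow> complex) \<Rightarrow> real \<Rightarrow> 'a \<Rightarrow> complex" where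
  "radon_data \<psi> \<mu> r \<sigma> w y \<theta> =
     (if y \<in> {-1..1} then prolate_inv \<psi> \<mu> (slice_data r \<sigma> w \<theta>) y else 0)"

end

theory Submission
  imports Defs "HOL-Probability.Characteristic_Functions"
begin

text \<open>
  Put \<open>V q = v (\<sigma> *\<^sub>R q)\<close>, a function that vanishes almost everywhere outside the unit ball, and write \<open>d\<close> for the dimension. For
  a unit vector \<open>\<theta>\<close> let \<open>u t\<close> be the integral of \<open>V\<close> over the hyperplane \<open>\<theta> \<bullet> q = t\<close>. Three facts carry
  the proof.

  First, integrating the function \<open>exp (\<i> * s * (\<theta> \<bullet> q)) * V q\<close> hyperplane by hyperplane gives
  \<open>\<integral> exp (\<i> * s * t) * u t dt = \<integral> exp (\<i> * s * (\<theta> \<bullet> q)) * V q dq\<close> for every real \<open>s\<close>. Since \<open>V\<close> lives in the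
  unit ball, \<open>u\<close> lives in \<open>[-1,1]\<close>, and by the Cauchy-Schwarz inequality it is square-integrable there,
  for every \<open>\<theta>\<close> and not only for almost every one (lemma \<open>ex_plane_integrals\<close>). For \<open>s = c * x\<close>
  with \<open>\<bar>x\<bar> < 1\<close> the right-hand side is, up to the normalising constant, the Fourier transform of \<open>v\<close> at
  \<open>r * x * \<theta>\<close>, a point of the ball on which the data are given. So the data on the diameter of direction
  \<open>\<theta>\<close> are the values of the prolate operator at \<open>u\<close> (lemma \<open>slice_data_eq_prolate_op\<close>).

  Second, the kernel \<open>exp (\<i> * c * x * y)\<close> is symmetric, so the coefficient of the data against
  \<open>\<psi> j\<close> is \<open>\<mu> j\<close> times the coefficient of \<open>u\<close>. The partial sums defining the inverse operator are
  therefore exactly the partial sums of the expansion of \<open>u\<close> in the orthonormal basis, and they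
  converge to \<open>u\<close> (lemma \<open>prolate_inv_partial_tendsto\<close>). Hence \<open>radon_data\<close> is the Radon transform
  of \<open>V\<close>. Its symmetry follows because the plane integrals for \<open>- \<theta>\<close>, reflected in \<open>t\<close>, have the
  same exponential integrals as those for \<open>\<theta>\<close>, so that both are limits of the same partial sums.

  Third, the exponential integrals of \<open>u\<close> are now known for all \<open>s\<close>, not only for \<open>\<bar>s\<bar> < c\<close>; they are
  the Fourier transform of \<open>V\<close> on the whole line through \<open>\<theta>\<close>. Polar coordinates (theorem \<open>integral_polar\<close>) turn
  the truncated inverse Radon transform into the Fourier integral of \<open>V\<close> truncated to the ball of
  radius \<open>R\<close>, and this converges to \<open>V\<close> in \<open>L\<^sup>2\<close> by Plancherel's theorem (theorem
  \<open>fourier_inversion_L2\<close>). Undoing the dilation gives \<open>v\<close>.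
\<close>

section \<open>Square-integrable functions and their limits\<close>

lemma cmod_le_1_plus_square: "cmod z \<le> 1 + (cmod z)\<^sup>2"
proof -
  have "2 * cmod z \<le> (cmod z)\<^sup>2 + 1"
    using sum_squares_bound[of "cmod z" 1] by simp
  then show ?thesis
    using norm_ge_zero[of z] by linarith
qed

lemma cmod_add_square_le: "(cmod (a + b))\<^sup>2 \<le> 2 * (cmod a)\<^sup>2 + 2 * (cmod b)\<^sup>2"
proof -
  have "(cmod (a + b))\<^sup>2 \<le> (cmod a + cmod b)\<^sup>2"
    by (intro power_mono norm_triangle_ineq) simp
  also have "\<dots> \<le> 2 * (cmod a)\<^sup>2 + 2 * (cmod b)\<^sup>2"
    using sum_squares_bound[of "cmod a" "cmod b"] by (simp add: power2_sum)
  finally show ?thesis .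
qed

lemma norm_mult_le_sum_squares: "cmod (a * b) \<le> ((cmod a)\<^sup>2 + (cmod b)\<^sup>2) / 2"
  using sum_squares_bound[of "cmod a" "cmod b"] by (simp add: norm_mult)

lemma integrable_mult_L2:
  assumes "f \<in> borel_measurable M" "g \<in> borel_measurable M"
    and "integrable M (\<lambda>x. (cmod (f x))\<^sup>2)" "integrable M (\<lambda>x. (cmod (g x))\<^sup>2)"
  shows "integrable M (\<lambda>x. f x * g x)"
  by (rule Bochner_Integration.integrable_bound[of _ "\<lambda>x. ((cmod (f x))\<^sup>2 + (cmod (g x))\<^sup>2) / 2"])
     (use assms norm_mult_le_sum_squares in auto)

lemma norm_integral_mult_le:
  fixes f g :: "'a \<Rightarrow> complex"
  assumes f[measurable]: "f \<in> borel_measurable M" and g[measurable]: "g \<in> borel_measurable M"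
    and f2: "integrable M (\<lambda>x. (cmod (f x))\<^sup>2)" and g2: "integrable M (\<lambda>x. (cmod (g x))\<^sup>2)"
  shows "(cmod (\<integral>x. f x * g x \<partial>M))\<^sup>2 \<le> (\<integral>x. (cmod (f x))\<^sup>2 \<partial>M) * (\<integral>x. (cmod (g x))\<^sup>2 \<partial>M)"
proof -
  have "ennreal (cmod (\<integral>x. f x * g x \<partial>M)) \<le> (\<integral>\<^sup>+x. ennreal (cmod (f x * g x)) \<partial>M)"
    by (intro integral_norm_bound_ennreal integrable_mult_L2 assms)
  then have "(ennreal (cmod (\<integral>x. f x * g x \<partial>M)))\<^sup>2 \<le> (\<integral>\<^sup>+x. ennreal (cmod (f x)) * ennreal (cmod (g x)) \<partial>M)\<^sup>2"
    by (intro power_mono) (auto simp: norm_mult ennreal_mult)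
  also have "\<dots> \<le> (\<integral>\<^sup>+x. (ennreal (cmod (f x)))\<^sup>2 \<partial>M) * (\<integral>\<^sup>+x. (ennreal (cmod (g x)))\<^sup>2 \<partial>M)"
    by (intro Cauchy_Schwarz_nn_integral) auto
  also have "\<dots> = ennreal ((\<integral>x. (cmod (f x))\<^sup>2 \<partial>M) * (\<integral>x. (cmod (g x))\<^sup>2 \<partial>M))"
    using f2 g2 by (simp add: ennreal_power nn_integral_eq_integral ennreal_mult)
  finally show ?thesis
    by (simp add: ennreal_power)
qed

lemma L2_diff:
  assumes "f \<in> L2 M" "g \<in> L2 M"
  shows "(\<lambda>x. f x - g x) \<in> L2 M"
proof -
  have [measurable]: "f \<in> borel_measurable M" "g \<in> borel_measurable M"
    using assms by (auto simp: L2_def)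
  have "integrable M (\<lambda>x. (cmod (f x - g x))\<^sup>2)"
  proof (rule Bochner_Integration.integrable_bound)
    show "integrable M (\<lambda>x. 2 * (cmod (f x))\<^sup>2 + 2 * (cmod (g x))\<^sup>2)"
      using assms by (auto simp: L2_def)
    show "AE x in M. norm ((cmod (f x - g x))\<^sup>2) \<le> norm (2 * (cmod (f x))\<^sup>2 + 2 * (cmod (g x))\<^sup>2)"
      using cmod_add_square_le[of "f _" "- g _"] by auto
  qed measurable
  then show ?thesis by (simp add: L2_def)
qed

lemma L2_tendsto_unique:
  assumes f: "L2_tendsto M u f F" and g: "L2_tendsto M u g F" and "F \<noteq> bot"
  shows "AE x in M. f x = g x"
proof -
  let ?d = "\<integral>x. (cmod (f x - g x))\<^sup>2 \<partial>M"
  have L2: "f \<in> L2 M" "g \<in> L2 M" "\<forall>\<^sub>F i in F. u i \<in> L2 M"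
    using f g by (auto simp: L2_tendsto_def)
  have lim: "((\<lambda>i. 2 * (\<integral>x. (cmod (u i x - f x))\<^sup>2 \<partial>M) + 2 * (\<integral>x. (cmod (u i x - g x))\<^sup>2 \<partial>M)) \<longlongrightarrow> 2 * 0 + 2 * 0) F"
    using f g by (intro tendsto_intros) (auto simp: L2_tendsto_def)
  have int: "integrable M (\<lambda>x. (cmod (a x - b x))\<^sup>2)" if "a \<in> L2 M" "b \<in> L2 M" for a b
    using L2_diff[OF that] by (simp add: L2_def)
  have "\<forall>\<^sub>F i in F. ?d \<le> 2 * (\<integral>x. (cmod (u i x - f x))\<^sup>2 \<partial>M) + 2 * (\<integral>x. (cmod (u i x - g x))\<^sup>2 \<partial>M)"
    using L2(3)
  proof eventually_elim
    fix i assume u: "u i \<in> L2 M"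
    have "?d \<le> (\<integral>x. 2 * (cmod (u i x - f x))\<^sup>2 + 2 * (cmod (u i x - g x))\<^sup>2 \<partial>M)"
    proof (rule integral_mono)
      show "(cmod (f x - g x))\<^sup>2 \<le> 2 * (cmod (u i x - f x))\<^sup>2 + 2 * (cmod (u i x - g x))\<^sup>2" for x
        using cmod_add_square_le[of "f x - u i x" "u i x - g x"] by (simp add: norm_minus_commute)
    qed (use int L2 u in auto)
    also have "\<dots> = 2 * (\<integral>x. (cmod (u i x - f x))\<^sup>2 \<partial>M) + 2 * (\<integral>x. (cmod (u i x - g x))\<^sup>2 \<partial>M)"
      using int[OF u L2(1)] int[OF u L2(2)] by simp
    finally show "?d \<le> \<dots>" .
  qed
  then have "?d \<le> 0"
    using tendsto_lowerbound[OF lim _ \<open>F \<noteq> bot\<close>] by simp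
  then have "?d = 0" by (simp add: antisym)
  then have "AE x in M. (cmod (f x - g x))\<^sup>2 = 0"
    using integral_nonneg_eq_0_iff_AE[OF int[OF L2(1,2)]] by simp
  then show ?thesis by simp
qed

text \<open>
  Although \<open>L2_lim\<close> is an arbitrary choice among the limits, any one limit that is known explicitly
  shows both that the choice is a limit and what it is up to a null set.
\<close>

lemma L2_lim_eq:
  assumes "L2_tendsto M u f F" "F \<noteq> bot"
  shows "L2_tendsto M u (L2_lim M u F) F" "AE x in M. L2_lim M u F x = f x"
proof -
  show "L2_tendsto M u (L2_lim M u F) F"
    unfolding L2_lim_def using assms(1) by (rule someI[where P="\<lambda>f. L2_tendsto M u f F"])
  then show "AE x in M. L2_lim M u F x = f x"
    using assms by (intro L2_tendsto_unique)
qed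

text \<open>
  At each point the truncation is either \<open>f\<close> or \<open>0\<close>, so the error is at most the modulus of \<open>f\<close> and
  dominated convergence applies.
\<close>

lemma L2_approx_bounded:
  fixes f :: "'a::euclidean_space \<Rightarrow> complex"
  assumes f[measurable]: "f \<in> borel_measurable lborel" and f2: "integrable lborel (\<lambda>x. (cmod (f x))\<^sup>2)"
  defines "T \<equiv> \<lambda>(m::nat) x. if norm x \<le> m \<and> cmod (f x) \<le> m then f x else 0"
  shows "(\<lambda>m. \<integral>x. (cmod (f x - T m x))\<^sup>2 \<partial>lborel) \<longlonglongrightarrow> 0"
proof -
  have [measurable]: "T m \<in> borel_measurable lborel" for m
    unfolding T_def by measurable
  have "(\<lambda>m. \<integral>x. (cmod (f x - T m x))\<^sup>2 \<partial>lborel) \<longlonglongrightarrow> (\<integral>x. 0 \<partial>(lborel :: 'a measure))"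
  proof (rule integral_dominated_convergence[OF _ _ f2])
    show "AE x in lborel. (\<lambda>m. (cmod (f x - T m x))\<^sup>2) \<longlonglongrightarrow> 0"
    proof (rule AE_I2)
      fix x
      obtain M :: nat where M: "norm x \<le> M" "cmod (f x) \<le> M"
        using real_arch_simple[of "max (norm x) (cmod (f x))"] by auto
      have "eventually (\<lambda>m. (cmod (f x - T m x))\<^sup>2 = 0) sequentially"
        using eventually_ge_at_top[of M]
        by eventually_elim (use M in \<open>auto simp: T_def intro: order_trans\<close>)
      then show "(\<lambda>m. (cmod (f x - T m x))\<^sup>2) \<longlonglongrightarrow> 0"
        by (rule tendsto_eventually)
    qed
  qed (auto simp: T_def)
  then show ?thesis by simp
qed

text \<open>
  A Lebesgue measurable function is an almost everywhere limit of continuous functions, but of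
  uncontrolled ones. After truncating \<open>f\<close> to a bounded function on a ball, projecting these continuous
  functions to the same disc of values and multiplying them by a cutoff makes them dominated, so
  that they converge in \<open>L\<^sup>2\<close> as well.
\<close>

lemma L2_approx_continuous:
  fixes f :: "'a::euclidean_space \<Rightarrow> complex"
  assumes f[measurable]: "f \<in> borel_measurable lborel" and f2: "integrable lborel (\<lambda>x. (cmod (f x))\<^sup>2)"
    and "0 < e"
  obtains g B where "continuous_on UNIV g" "\<And>x. cmod (g x) \<le> B"
    "integrable lborel (\<lambda>x. (cmod (f x - g x))\<^sup>2)" "(\<integral>x. (cmod (f x - g x))\<^sup>2 \<partial>lborel) < e"
proof -
  define T where "T = (\<lambda>(m::nat) x. if norm x \<le> m \<and> cmod (f x) \<le> m then f x else 0)"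
  have [measurable]: "T m \<in> borel_measurable lborel" for m
    unfolding T_def by measurable
  from L2_approx_bounded[OF f f2] have "(\<lambda>m. \<integral>x. (cmod (f x - T m x))\<^sup>2 \<partial>lborel) \<longlonglongrightarrow> 0"
    by (simp add: T_def)
  from order_tendstoD(2)[OF this, of "e/4"] \<open>0 < e\<close>
  obtain m where m: "(\<integral>x. (cmod (f x - T m x))\<^sup>2 \<partial>lborel) < e / 4"
    by (auto simp: eventually_sequentially)
  have "T m \<in> borel_measurable lebesgue"
    by (intro measurable_completion) auto
  then have "T m measurable_on UNIV"
    by (intro lebesgue_measurable_imp_measurable_on) auto
  then obtain N G where N: "negligible N" and G: "\<And>n. continuous_on UNIV (G n)"
    and lim: "\<And>x. x \<notin> N \<Longrightarrow> (\<lambda>n. G n x) \<longlonglongrightarrow> T m x"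
    unfolding measurable_on_def by auto
  define clip :: "complex \<Rightarrow> complex" where "clip = closest_point (cball 0 m)"
  define cut :: "'a \<Rightarrow> real" where "cut = (\<lambda>x. max 0 (min 1 (m + 1 - norm x)))"
  define H where "H = (\<lambda>n x. cut x *\<^sub>R clip (G n x))"
  have clip_cont: "continuous_on UNIV clip"
    unfolding clip_def by (intro continuous_on_closest_point) auto
  have clip_le: "cmod (clip w) \<le> m" for w
    using closest_point_in_set[of "cball (0::complex) m" w] by (auto simp: clip_def)
  have clip_T: "clip (T m x) = T m x" for x
    unfolding clip_def by (rule closest_point_self) (auto simp: T_def)
  have H_cont: "continuous_on UNIV (H n)" for n
    unfolding H_def cut_def
    by (intro continuous_intros continuous_on_compose2[OF clip_cont G]) auto
  have [measurable]: "H n \<in> borel_measurable lborel" for n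
    using H_cont by (simp add: borel_measurable_continuous_onI)
  have cut_abs: "\<bar>cut x\<bar> \<le> indicator (cball 0 (m+1)) x" for x
    by (auto simp: cut_def indicator_def)
  have H_le: "cmod (H n x) \<le> real m * indicat_real (cball 0 (m+1)) x" for n x
    using mult_mono[OF cut_abs[of x] clip_le[of "G n x"]] by (simp add: H_def mult.commute)
  have T_le: "cmod (T m x) \<le> real m * indicat_real (cball 0 (m+1)) x" for x
    by (auto simp: T_def indicator_def)
  have dom: "(cmod (T m x - H n x))\<^sup>2 \<le> (2 * real m)\<^sup>2 * indicat_real (cball 0 (m+1)) x" for n x
  proof -
    have "cmod (T m x - H n x) \<le> 2 * real m * indicat_real (cball 0 (m+1)) x"
      using norm_triangle_ineq4[of "T m x" "H n x"] T_le[of x] H_le[of n x] by linarith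
    then have "(cmod (T m x - H n x))\<^sup>2 \<le> (2 * real m * indicat_real (cball 0 (m+1)) x)\<^sup>2"
      by (rule power_mono) simp
    also have "\<dots> = (2 * real m)\<^sup>2 * indicat_real (cball 0 (m+1)) x"
      by (auto simp: indicator_def)
    finally show ?thesis .
  qed
  have ind_int: "integrable lborel (\<lambda>x::'a. (2 * real m)\<^sup>2 * indicator (cball 0 (m+1)) x)"
    using emeasure_lborel_cball_finite[of "0::'a" "m+1"]
    by (intro integrable_mult_right integrable_real_indicator) auto
  have "(\<lambda>n. \<integral>x. (cmod (T m x - H n x))\<^sup>2 \<partial>lborel) \<longlonglongrightarrow> (\<integral>x. 0 \<partial>(lborel :: 'a measure))"
  proof (rule integral_dominated_convergence[OF _ _ ind_int])
    have "AE x in lborel. x \<notin> N"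
      using N by (metis AE_completion_iff AE_not_in negligible_iff_null_sets)
    then show "AE x in lborel. (\<lambda>n. (cmod (T m x - H n x))\<^sup>2) \<longlonglongrightarrow> 0"
    proof eventually_elim
      fix x assume "x \<notin> N"
      have "(\<lambda>n. H n x) \<longlonglongrightarrow> cut x *\<^sub>R clip (T m x)"
        unfolding H_def
        by (intro tendsto_intros continuous_on_tendsto_compose[OF clip_cont lim[OF \<open>x \<notin> N\<close>]]) auto
      also have "cut x *\<^sub>R clip (T m x) = T m x"
        unfolding clip_T by (auto simp: cut_def T_def)
      finally have "(\<lambda>n. (cmod (T m x - H n x))\<^sup>2) \<longlonglongrightarrow> (cmod (T m x - T m x))\<^sup>2"
        by (intro tendsto_intros)
      then show "(\<lambda>n. (cmod (T m x - H n x))\<^sup>2) \<longlonglongrightarrow> 0" by simp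
    qed
  qed (use dom in \<open>auto simp: \<close>)
  then have "(\<lambda>n. \<integral>x. (cmod (T m x - H n x))\<^sup>2 \<partial>lborel) \<longlonglongrightarrow> 0" by simp
  from order_tendstoD(2)[OF this, of "e/4"] \<open>0 < e\<close>
  obtain n where n: "(\<integral>x. (cmod (T m x - H n x))\<^sup>2 \<partial>lborel) < e / 4"
    by (auto simp: eventually_sequentially)
  have i1: "integrable lborel (\<lambda>x. (cmod (f x - T m x))\<^sup>2)"
    by (rule Bochner_Integration.integrable_bound[OF f2]) (auto simp: T_def)
  have i2: "integrable lborel (\<lambda>x. (cmod (T m x - H n x))\<^sup>2)"
    by (rule Bochner_Integration.integrable_bound[OF ind_int]) (use dom[of _ n] in auto)
  have le: "(cmod (f x - H n x))\<^sup>2 \<le> 2 * (cmod (f x - T m x))\<^sup>2 + 2 * (cmod (T m x - H n x))\<^sup>2" for x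
    using cmod_add_square_le[of "f x - T m x" "T m x - H n x"] by simp
  have i3: "integrable lborel (\<lambda>x. (cmod (f x - H n x))\<^sup>2)"
    by (rule Bochner_Integration.integrable_bound[of _ "\<lambda>x. 2 * (cmod (f x - T m x))\<^sup>2 + 2 * (cmod (T m x - H n x))\<^sup>2"])
       (use le i1 i2 in auto)
  show thesis
  proof (rule that)
    show "continuous_on UNIV (H n)" by (rule H_cont)
    show "cmod (H n x) \<le> m" for x
      by (rule order_trans[OF H_le]) (simp add: indicator_def)
    have "(\<integral>x. (cmod (f x - H n x))\<^sup>2 \<partial>lborel) \<le> (\<integral>x. 2 * (cmod (f x - T m x))\<^sup>2 + 2 * (cmod (T m x - H n x))\<^sup>2 \<partial>lborel)"
      using i1 i2 i3 le by (intro integral_mono) auto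
    also have "\<dots> < e"
      using i1 i2 m n by simp
    finally show "(\<integral>x. (cmod (f x - H n x))\<^sup>2 \<partial>lborel) < e" .
  qed (rule i3)
qed

section \<open>Lebesgue measure under translations and dilations\<close>

lemma lborel_translate:
  fixes f :: "'a::euclidean_space \<Rightarrow> 'b::{banach, second_countable_topology}"
  assumes [measurable]: "f \<in> borel_measurable borel"
  shows "integrable lborel (\<lambda>x. f (h + x)) \<longleftrightarrow> integrable lborel f"
    and "(\<integral>x. f (h + x) \<partial>lborel) = (\<integral>x. f x \<partial>lborel)"
proof -
  have "integrable (distr lborel borel ((+) h)) f \<longleftrightarrow> integrable lborel (\<lambda>x. f (h + x))"
    by (intro integrable_distr_eq) auto
  then show "integrable lborel (\<lambda>x. f (h + x)) \<longleftrightarrow> integrable lborel f"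
    by (simp add: lborel_distr_plus)
  have "integral\<^sup>L (distr lborel borel ((+) h)) f = (\<integral>x. f (h + x) \<partial>lborel)"
    by (intro integral_distr) auto
  then show "(\<integral>x. f (h + x) \<partial>lborel) = (\<integral>x. f x \<partial>lborel)"
    by (simp add: lborel_distr_plus)
qed

lemma nn_integral_translate:
  fixes F :: "'a::euclidean_space \<Rightarrow> ennreal"
  assumes [measurable]: "F \<in> borel_measurable borel"
  shows "(\<integral>\<^sup>+x. F (h + x) \<partial>lborel) = (\<integral>\<^sup>+x. F x \<partial>lborel)"
proof -
  have "(\<integral>\<^sup>+x. F x \<partial>distr lborel borel ((+) h)) = (\<integral>\<^sup>+x. F (h + x) \<partial>lborel)"
    by (intro nn_integral_distr) auto
  then show ?thesis by (simp add: lborel_distr_plus)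
qed

lemma lborel_scaleR:
  fixes f :: "'a::euclidean_space \<Rightarrow> 'b::{banach, second_countable_topology}"
  assumes [measurable]: "f \<in> borel_measurable borel" and "c \<noteq> 0"
  shows "integrable lborel (\<lambda>x. f (c *\<^sub>R x)) \<longleftrightarrow> integrable lborel f"
    and "(\<integral>x. f x \<partial>lborel) = (\<bar>c\<bar> ^ DIM('a)) *\<^sub>R (\<integral>x. f (c *\<^sub>R x) \<partial>lborel)"
proof -
  have eq: "lborel = density (distr lborel borel (\<lambda>x::'a. c *\<^sub>R x)) (\<lambda>_. \<bar>c\<bar>^DIM('a))"
    using lborel_affine[OF \<open>c \<noteq> 0\<close>, of "0::'a"] by simp
  show "integrable lborel (\<lambda>x. f (c *\<^sub>R x)) \<longleftrightarrow> integrable lborel f"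
  proof -
    have "integrable lborel f \<longleftrightarrow> integrable lborel (\<lambda>x. \<bar>c\<bar>^DIM('a) *\<^sub>R f (c *\<^sub>R x))"
      by (subst eq) (simp add: integrable_density integrable_distr_eq)
    moreover have "integrable lborel (\<lambda>x. f (c *\<^sub>R x))" if "integrable lborel (\<lambda>x. \<bar>c\<bar>^DIM('a) *\<^sub>R f (c *\<^sub>R x))"
      using integrable_scaleR_right[OF that, of "inverse (\<bar>c\<bar>^DIM('a))"] \<open>c \<noteq> 0\<close> by simp
    ultimately show ?thesis by auto
  qed
  show "(\<integral>x. f x \<partial>lborel) = (\<bar>c\<bar> ^ DIM('a)) *\<^sub>R (\<integral>x. f (c *\<^sub>R x) \<partial>lborel)"
    by (subst eq) (simp add: integral_density integral_distr)
qed

text \<open>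
  No measurability of \<open>P\<close> is available in the applications, so the dilation is applied to a measurable
  null set containing the exceptions.
\<close>

lemma AE_lborel_scaleR:
  fixes P :: "'a::euclidean_space \<Rightarrow> bool"
  assumes P: "AE x in lborel. P x" and "c \<noteq> 0"
  shows "AE x in lborel. P (c *\<^sub>R x)"
proof -
  obtain N where N: "N \<in> null_sets lborel" "{x. \<not> P x} \<subseteq> N"
    using P by (auto elim!: AE_E simp: null_sets_def)
  have [measurable]: "N \<in> sets borel" using N by auto
  have eq: "lborel = density (distr lborel borel (\<lambda>x::'a. (1 / c) *\<^sub>R x)) (\<lambda>_. \<bar>1 / c\<bar> ^ DIM('a))"
    using lborel_affine[of "1 / c" "0::'a"] \<open>c \<noteq> 0\<close> by simp
  have "AE x in lborel. c *\<^sub>R x \<notin> N"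
    using \<open>c \<noteq> 0\<close> AE_not_in[OF N(1)]
    by (subst eq) (simp add: AE_density AE_distr_iff)
  then show ?thesis
    by eventually_elim (use N(2) in auto)
qed

section \<open>The Fourier transform of the Gaussian density\<close>

lemma borel_measurable_cis [measurable]: "cis \<in> borel_measurable borel"
  by (intro borel_measurable_continuous_onI continuous_intros)

lemma borel_measurable_cnj [measurable (raw)]: "f \<in> borel_measurable M \<Longrightarrow> (\<lambda>x. cnj (f x)) \<in> borel_measurable M"
  by (rule measurable_compose[OF _ borel_measurable_continuous_onI]) (auto intro: continuous_intros)

lemma cis_sum: "finite I \<Longrightarrow> cis (\<Sum>i\<in>I. f i) = (\<Prod>i\<in>I. cis (f i))"
  by (induction I rule: finite_induct) (simp_all add: cis_mult [symmetric])

definition gauss :: "'a::euclidean_space \<Rightarrow> real" where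
  "gauss z = (\<Prod>b\<in>Basis. std_normal_density (z \<bullet> b))"

lemma sum_half_inner_squares: "(\<Sum>b\<in>Basis. - ((z::'a::euclidean_space) \<bullet> b)\<^sup>2 / 2) = - (norm z)\<^sup>2 / 2"
  by (simp add: norm_eq_sqrt_inner[of z] euclidean_inner[of z z] power2_eq_square sum_divide_distrib sum_negf sum_nonneg)

lemma gauss_eq: "gauss (z::'a::euclidean_space) = exp (- (norm z)\<^sup>2 / 2) / sqrt (2 * pi) ^ DIM('a)"
proof -
  have "gauss z = (\<Prod>b\<in>Basis. exp (- (z \<bullet> b)\<^sup>2 / 2) / sqrt (2 * pi))"
    by (simp add: gauss_def std_normal_density_def)
  also have "\<dots> = exp (\<Sum>b\<in>Basis. - (z \<bullet> b)\<^sup>2 / 2) / sqrt (2 * pi) ^ DIM('a)"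
    by (simp add: prod_dividef exp_sum)
  also have "(\<Sum>b\<in>Basis. - (z \<bullet> b)\<^sup>2 / 2) = - (norm z)\<^sup>2 / 2"
    by (rule sum_half_inner_squares)
  finally show ?thesis .
qed

text \<open>
  Both the exponential and the density are products over the coordinates, which reduces the claim
  to the characteristic function of the standard normal distribution on the line.
\<close>

lemma fourier_gauss:
  fixes z :: "'a::euclidean_space"
  shows "integrable lborel (\<lambda>p. cis (z \<bullet> p) * complex_of_real (gauss p))" (is ?int)
    and "(\<integral>p. cis (z \<bullet> p) * complex_of_real (gauss p) \<partial>lborel) = complex_of_real (exp (- (norm z)\<^sup>2 / 2))" (is ?eq)
proof -
  interpret product_sigma_finite "\<lambda>b::'a. lborel :: real measure" ..
  let ?f = "\<lambda>(b::'a) t. cis ((z \<bullet> b) * t) * complex_of_real (std_normal_density t)"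
  have f_int: "integrable lborel (?f b)" for b
  proof (rule Bochner_Integration.integrable_bound)
    show "integrable lborel std_normal_density" by simp
  qed (auto simp: norm_mult)
  have f_eq: "(\<integral>t. ?f b t \<partial>lborel) = complex_of_real (exp (- (z \<bullet> b)\<^sup>2 / 2))" for b
  proof -
    have "(\<integral>t. ?f b t \<partial>lborel) = char std_normal_distribution (z \<bullet> b)"
      unfolding char_def
      by (subst integral_density) (auto simp: scaleR_conv_of_real mult.commute cis_conv_exp)
    then show ?thesis by (simp add: char_std_normal_distribution)
  qed
  have expand: "cis (z \<bullet> p) * complex_of_real (gauss p) = (\<Prod>b\<in>Basis. ?f b (p \<bullet> b))" for p
  proof -
    have "z \<bullet> p = (\<Sum>b\<in>Basis. (z \<bullet> b) * (p \<bullet> b))"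
      by (rule euclidean_inner)
    then show ?thesis
      by (simp add: cis_sum gauss_def prod.distrib)
  qed
  have coord: "(\<Prod>b\<in>Basis. ?f b ((\<Sum>b'\<in>Basis. x b' *\<^sub>R b') \<bullet> b)) = (\<Prod>b\<in>Basis. ?f b (x b))" for x
    by (intro prod.cong) auto
  have prod_meas [measurable]: "(\<lambda>p::'a. (\<Prod>b\<in>Basis. ?f b (p \<bullet> b))) \<in> borel_measurable borel"
    by measurable
  have T [measurable]: "(\<lambda>x. \<Sum>b\<in>Basis. x b *\<^sub>R b) \<in> (\<Pi>\<^sub>M b\<in>(Basis::'a set). lborel) \<rightarrow>\<^sub>M borel"
    by measurable
  have "integrable (distr (\<Pi>\<^sub>M b\<in>(Basis::'a set). lborel) borel (\<lambda>x. \<Sum>b\<in>Basis. x b *\<^sub>R b))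
          (\<lambda>p. \<Prod>b\<in>Basis. ?f b (p \<bullet> b))"
    unfolding integrable_distr_eq[OF T prod_meas] coord
    by (intro product_integrable_prod f_int finite_Basis)
  then show ?int
    unfolding expand lborel_eq[where 'a='a] .
  have "(\<integral>p. cis (z \<bullet> p) * complex_of_real (gauss p) \<partial>lborel) =
      integral\<^sup>L (distr (\<Pi>\<^sub>M b\<in>(Basis::'a set). lborel) borel (\<lambda>x. \<Sum>b\<in>Basis. x b *\<^sub>R b))
          (\<lambda>p. \<Prod>b\<in>Basis. ?f b (p \<bullet> b))"
    unfolding expand by (simp only: lborel_eq[where 'a='a])
  also have "\<dots> = (\<Prod>b\<in>Basis. \<integral>t. ?f b t \<partial>lborel)"
    unfolding integral_distr[OF T prod_meas] coord
    by (intro product_integral_prod f_int finite_Basis)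
  also have "\<dots> = (\<Prod>b\<in>Basis. complex_of_real (exp (- (z \<bullet> b)\<^sup>2 / 2)))"
    by (simp only: f_eq)
  also have "\<dots> = complex_of_real (exp (\<Sum>b\<in>Basis. - (z \<bullet> b)\<^sup>2 / 2))"
    by (simp add: exp_sum)
  also have "(\<Sum>b\<in>Basis. - (z \<bullet> b)\<^sup>2 / 2) = - (norm z)\<^sup>2 / 2"
    by (rule sum_half_inner_squares)
  finally show ?eq .
qed

lemma integrable_gauss: "integrable lborel (gauss :: 'a::euclidean_space \<Rightarrow> real)"
  and integral_gauss: "(\<integral>p. gauss (p::'a) \<partial>lborel) = 1"
proof -
  have "integrable lborel (\<lambda>p::'a. complex_of_real (gauss p))" "(\<integral>p. complex_of_real (gauss (p::'a)) \<partial>lborel) = 1"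
    using fourier_gauss[of "0::'a"] by simp_all
  then show "integrable lborel (gauss :: 'a \<Rightarrow> real)" "(\<integral>p. gauss (p::'a) \<partial>lborel) = 1"
    by (simp_all add: complex_of_real_integrable_eq)
qed

section \<open>Plancherel's theorem\<close>

text \<open>
  The squared modulus of the Fourier transform of \<open>f\<close> is the Fourier transform of this function,
  whose value at \<open>0\<close> is the squared \<open>L\<^sup>2\<close> norm of \<open>f\<close>. Plancherel's theorem is thus Fourier
  inversion for \<open>autocorr f\<close> at the single point \<open>0\<close>.
\<close>

definition autocorr :: "('a::euclidean_space \<Rightarrow> complex) \<Rightarrow> 'a \<Rightarrow> complex" where
  "autocorr f h = (\<integral>x. f (h + x) * cnj (f x) \<partial>lborel)"

context
  fixes f :: "'a::euclidean_space \<Rightarrow> complex"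
  assumes f [measurable]: "f \<in> borel_measurable borel"
    and f1: "integrable lborel f"
    and f2: "integrable lborel (\<lambda>x. (cmod (f x))\<^sup>2)"
begin

private lemma f2_translate: "integrable lborel (\<lambda>x. (cmod (f (h + x)))\<^sup>2)"
  using lborel_translate(1)[of "\<lambda>x. (cmod (f x))\<^sup>2" h] f2 by simp

lemma autocorr_integrable: "integrable lborel (\<lambda>x. f (h + x) * cnj (f x))"
  by (rule integrable_mult_L2) (use f2 f2_translate[of h] in auto)

lemma autocorr_measurable [measurable]: "autocorr f \<in> borel_measurable borel"
proof -
  have "(\<lambda>h. \<integral>x. f (h + x) * cnj (f x) \<partial>lborel) \<in> borel_measurable lborel"
    by (intro lborel.borel_measurable_lebesgue_integral) measurable
  then show ?thesis by (simp add: autocorr_def[abs_def])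
qed

lemma autocorr_0: "autocorr f 0 = complex_of_real (\<integral>x. (cmod (f x))\<^sup>2 \<partial>lborel)"
  by (simp add: autocorr_def complex_norm_square [symmetric] flip: of_real_power)

lemma autocorr_bound: "cmod (autocorr f h) \<le> (\<integral>x. (cmod (f x))\<^sup>2 \<partial>lborel)"
proof -
  let ?E = "\<integral>x. (cmod (f x))\<^sup>2 \<partial>lborel"
  have "(cmod (autocorr f h))\<^sup>2 \<le> (\<integral>x. (cmod (f (h + x)))\<^sup>2 \<partial>lborel) * (\<integral>x. (cmod (cnj (f x)))\<^sup>2 \<partial>lborel)"
    unfolding autocorr_def by (rule norm_integral_mult_le) (use f2 f2_translate[of h] in auto)
  also have "\<dots> = ?E\<^sup>2"
    using lborel_translate(2)[of "\<lambda>x. (cmod (f x))\<^sup>2" h] by (simp only: power2_eq_square[of ?E]) simp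
  finally show ?thesis
    by (rule power2_le_imp_le) simp
qed

text \<open>
  Replace the shifted factor by a bounded continuous \<open>g\<close> close to \<open>f\<close> in \<open>L\<^sup>2\<close>. By the
  Cauchy-Schwarz inequality the error is small uniformly in the shift, and with \<open>g\<close> in place of \<open>f\<close>
  the limit is dominated convergence, because \<open>f\<close> is integrable and \<open>g\<close> is bounded.
\<close>

lemma autocorr_tendsto:
  assumes h: "(h \<longlongrightarrow> 0) sequentially"
  shows "(\<lambda>n. autocorr f (h n)) \<longlonglongrightarrow> autocorr f 0"
proof (rule LIMSEQ_I)
  let ?E = "\<integral>x. (cmod (f x))\<^sup>2 \<partial>lborel"
  fix e :: real assume "0 < e"
  have E: "0 \<le> ?E" by simp
  \<comment> \<open>The product of \<open>d\<close> with the squared norm of \<open>f\<close> stays below \<open>(e / 4)\<^sup>2\<close>; the added \<open>1\<close> covers \<open>f = 0\<close>.\<close>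
  define d where "d = (e / 4)\<^sup>2 / (?E + 1)"
  have "0 < ?E + 1" using E by linarith
  then have "0 < d" using \<open>0 < e\<close> unfolding d_def by (intro divide_pos_pos zero_less_power) auto
  obtain g B where g: "continuous_on UNIV g" and B: "\<And>x. cmod (g x) \<le> B"
    and fg: "integrable lborel (\<lambda>x. (cmod (f x - g x))\<^sup>2)" "(\<integral>x. (cmod (f x - g x))\<^sup>2 \<partial>lborel) < d"
    using L2_approx_continuous[of f d] f2 \<open>0 < d\<close> by auto
  have [measurable]: "g \<in> borel_measurable borel"
    using g by (rule borel_measurable_continuous_onI)
  have fgh: "integrable lborel (\<lambda>x. (cmod (f (k + x) - g (k + x)))\<^sup>2)" for k
    using lborel_translate(1)[of "\<lambda>x. (cmod (f x - g x))\<^sup>2" k] fg by simp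
  have gf: "integrable lborel (\<lambda>x. g (k + x) * cnj (f x))" for k
  proof (rule Bochner_Integration.integrable_bound)
    show "integrable lborel (\<lambda>x. B * cmod (f x))" using f1 by auto
    have "0 \<le> B" using B[of 0] norm_ge_zero order_trans by blast
    then show "AE x in lborel. cmod (g (k + x) * cnj (f x)) \<le> norm (B * cmod (f x))"
      using B by (auto simp: norm_mult intro!: mult_right_mono)
  qed auto
  have small: "cmod (autocorr f k - (\<integral>x. g (k + x) * cnj (f x) \<partial>lborel)) < e / 4" for k
  proof -
    have "autocorr f k - (\<integral>x. g (k + x) * cnj (f x) \<partial>lborel) = (\<integral>x. (f (k + x) - g (k + x)) * cnj (f x) \<partial>lborel)"
      unfolding autocorr_def using autocorr_integrable gf by (simp add: left_diff_distrib)
    also have "(cmod \<dots>)\<^sup>2 \<le> (\<integral>x. (cmod (f (k + x) - g (k + x)))\<^sup>2 \<partial>lborel) * (\<integral>x. (cmod (cnj (f x)))\<^sup>2 \<partial>lborel)"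
      by (rule norm_integral_mult_le) (use f2 fgh in auto)
    also have "\<dots> = (\<integral>x. (cmod (f x - g x))\<^sup>2 \<partial>lborel) * ?E"
      by (simp add: lborel_translate(2)[of "\<lambda>x. (cmod (f x - g x))\<^sup>2"])
    also have "\<dots> \<le> d * ?E"
      using fg E by (intro mult_right_mono) auto
    also have "\<dots> < d * (?E + 1)"
      using \<open>0 < d\<close> by simp
    also have "\<dots> = (e / 4)\<^sup>2"
      using \<open>0 < ?E + 1\<close> by (simp add: d_def)
    finally show ?thesis
      by (rule power2_less_imp_less) (use \<open>0 < e\<close> in auto)
  qed
  have "(\<lambda>n. \<integral>x. g (h n + x) * cnj (f x) \<partial>lborel) \<longlonglongrightarrow> (\<integral>x. g (0 + x) * cnj (f x) \<partial>lborel)"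
  proof (rule integral_dominated_convergence[where w="\<lambda>x. B * cmod (f x)"])
    show "AE x in lborel. (\<lambda>n. g (h n + x) * cnj (f x)) \<longlonglongrightarrow> g (0 + x) * cnj (f x)"
      by (intro AE_I2 tendsto_intros continuous_on_tendsto_compose[OF g] h) auto
    show "AE x in lborel. norm (g (h n + x) * cnj (f x)) \<le> B * cmod (f x)" for n
      using B by (auto simp: norm_mult intro!: mult_right_mono)
  qed (use f1 in auto)
  from LIMSEQ_D[OF this, of "e/4"] \<open>0 < e\<close> obtain N where
    N: "\<And>n. n \<ge> N \<Longrightarrow> cmod ((\<integral>x. g (h n + x) * cnj (f x) \<partial>lborel) - (\<integral>x. g (0 + x) * cnj (f x) \<partial>lborel)) < e / 4"
    by auto
  show "\<exists>no. \<forall>n\<ge>no. cmod (autocorr f (h n) - autocorr f 0) < e"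
  proof (intro exI allI impI)
    fix n assume "n \<ge> N"
    let ?G = "\<lambda>k. \<integral>x. g (k + x) * cnj (f x) \<partial>lborel"
    have triangle: "cmod (a - c) \<le> cmod (a - a') + cmod (a' - c') + cmod (c - c')" for a a' c c' :: complex
      using norm_triangle_ineq4[of "(a - a') + (a' - c')" "c - c'"] norm_triangle_ineq[of "a - a'" "a' - c'"] by simp
    have "cmod (autocorr f (h n) - autocorr f 0)
        \<le> cmod (autocorr f (h n) - ?G (h n)) + cmod (?G (h n) - ?G 0) + cmod (autocorr f 0 - ?G 0)"
      by (rule triangle)
    also have "\<dots> < e / 4 + e / 4 + e / 4"
      by (intro add_strict_mono small N[OF \<open>n \<ge> N\<close>])
    also have "\<dots> \<le> e"
      using \<open>0 < e\<close> by simp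
    finally show "cmod (autocorr f (h n) - autocorr f 0) < e" .
  qed
qed

lemma integrable_autocorr_pair:
  "integrable (lborel \<Otimes>\<^sub>M lborel) (\<lambda>(x, h). f (h + x) * cnj (f x))"
proof (rule lborel_pair.Fubini_integrable)
  have *: "(\<integral>y. cmod (f (y + x)) \<partial>lborel) = (\<integral>y. cmod (f y) \<partial>lborel)" for x
    using lborel_translate(2)[of "\<lambda>y. cmod (f y)" x] by (simp add: add.commute)
  show "integrable lborel (\<lambda>x. \<integral>y. norm (case (x, y) of (x, h) \<Rightarrow> f (h + x) * cnj (f x)) \<partial>lborel)"
    using f1 by (simp add: norm_mult *)
  show "AE x in lborel. integrable lborel (\<lambda>y. case (x, y) of (x, h) \<Rightarrow> f (h + x) * cnj (f x))"
    using f1 lborel_translate(1)[of f] by (auto simp: add.commute)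
qed measurable

lemma autocorr_L1: "integrable lborel (autocorr f)"
  using lborel_pair.integrable_snd[OF integrable_autocorr_pair] by (simp add: autocorr_def[abs_def])

text \<open>
  Writing the square as a double integral over \<open>x\<close> and \<open>y\<close> and substituting \<open>y = x + h\<close> leaves the
  exponential depending on \<open>h\<close> alone.
\<close>

lemma cmod_fourier_square:
  "complex_of_real ((cmod (\<integral>x. cis (p \<bullet> x) * f x \<partial>lborel))\<^sup>2) = (\<integral>h. cis (p \<bullet> h) * autocorr f h \<partial>lborel)"
proof -
  let ?F = "\<integral>x. cis (p \<bullet> x) * f x \<partial>lborel"
  have "complex_of_real ((cmod ?F)\<^sup>2) = ?F * cnj ?F"
    by (rule complex_norm_square)
  also have "\<dots> = (\<integral>x. ?F * cnj (cis (p \<bullet> x) * f x) \<partial>lborel)"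
    unfolding Bochner_Integration.integral_cnj[symmetric] by (rule integral_mult_right_zero[symmetric])
  also have "\<dots> = (\<integral>x. \<integral>h. cis (p \<bullet> h) * (f (h + x) * cnj (f x)) \<partial>lborel \<partial>lborel)"
  proof (rule Bochner_Integration.integral_cong[OF refl])
    fix x
    have "?F = (\<integral>h. cis (p \<bullet> (x + h)) * f (x + h) \<partial>lborel)"
      by (subst lborel_translate(2)[of "\<lambda>x. cis (p \<bullet> x) * f x"]) auto
    then have "?F * cnj (cis (p \<bullet> x) * f x) = (\<integral>h. cis (p \<bullet> (x + h)) * f (x + h) * cnj (cis (p \<bullet> x) * f x) \<partial>lborel)"
      by simp
    also have "\<dots> = (\<integral>h. cis (p \<bullet> h) * (f (h + x) * cnj (f x)) \<partial>lborel)"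
    proof (rule Bochner_Integration.integral_cong[OF refl])
      fix h
      have "cis (p \<bullet> (x + h)) * f (x + h) * cnj (cis (p \<bullet> x) * f x) =
          (cis (p \<bullet> (x + h)) * cis (- (p \<bullet> x))) * (f (x + h) * cnj (f x))"
        by (simp only: complex_cnj_mult cis_cnj mult_ac)
      also have "cis (p \<bullet> (x + h)) * cis (- (p \<bullet> x)) = cis (p \<bullet> h)"
        by (simp add: cis_mult inner_add_right)
      finally show "cis (p \<bullet> (x + h)) * f (x + h) * cnj (cis (p \<bullet> x) * f x) = cis (p \<bullet> h) * (f (h + x) * cnj (f x))"
        by (simp only: add.commute[of x h])
    qed
    finally show "?F * cnj (cis (p \<bullet> x) * f x) = (\<integral>h. cis (p \<bullet> h) * (f (h + x) * cnj (f x)) \<partial>lborel)" .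
  qed
  also have "\<dots> = (\<integral>h. \<integral>x. cis (p \<bullet> h) * (f (h + x) * cnj (f x)) \<partial>lborel \<partial>lborel)"
  proof (rule lborel_pair.Fubini_integral[symmetric])
    show "integrable (lborel \<Otimes>\<^sub>M lborel) (\<lambda>(x, h). cis (p \<bullet> h) * (f (h + x) * cnj (f x)))"
      by (rule Bochner_Integration.integrable_bound[OF integrable_autocorr_pair]) (auto simp: norm_mult)
  qed
  finally show ?thesis by (simp add: autocorr_def)
qed

text \<open>
  The Gaussian weight makes the double integral over \<open>p\<close> and \<open>h\<close> absolutely convergent. Integrating
  over \<open>p\<close> first produces a Gaussian of width \<open>t\<close> in \<open>h\<close>, and the substitution \<open>h = t *\<^sub>R z\<close> moves
  \<open>t\<close> into the argument of \<open>autocorr f\<close>.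
\<close>

lemma fourier_gauss_weighted:
  assumes t: "0 < t"
  shows "integrable lborel (\<lambda>p. (cmod (\<integral>x. cis (p \<bullet> x) * f x \<partial>lborel))\<^sup>2 * gauss (t *\<^sub>R p))"
    and "complex_of_real (\<integral>p. (cmod (\<integral>x. cis (p \<bullet> x) * f x \<partial>lborel))\<^sup>2 * gauss (t *\<^sub>R p) \<partial>lborel)
       = (\<integral>z. autocorr f (t *\<^sub>R z) * complex_of_real (exp (- (norm z)\<^sup>2 / 2)) \<partial>lborel)"
proof -
  have [measurable]: "gauss \<in> borel_measurable borel"
    using borel_measurable_integrable[OF integrable_gauss] by simp
  have gi: "integrable lborel (\<lambda>p::'a. gauss (t *\<^sub>R p))"
    using t integrable_gauss by (subst lborel_scaleR(1)) auto
  let ?k = "\<lambda>p h. cis (p \<bullet> h) * autocorr f h * complex_of_real (gauss (t *\<^sub>R p))"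
  have int: "integrable (lborel \<Otimes>\<^sub>M lborel) (\<lambda>(p, h). ?k p h)"
  proof (rule lborel_pair.Fubini_integrable)
    show "integrable lborel (\<lambda>x. \<integral>y. norm (case (x, y) of (p, h) \<Rightarrow> ?k p h) \<partial>lborel)"
      using gi autocorr_L1 by (simp add: norm_mult)
    show "AE x in lborel. integrable lborel (\<lambda>y. case (x, y) of (p, h) \<Rightarrow> ?k p h)"
    proof (rule AE_I2)
      fix p
      have "integrable lborel (\<lambda>h. cis (p \<bullet> h) * autocorr f h)"
        by (rule Bochner_Integration.integrable_bound[OF autocorr_L1]) (auto simp: norm_mult)
      then show "integrable lborel (\<lambda>y. case (p, y) of (p, h) \<Rightarrow> ?k p h)" by simp
    qed
  qed measurable
  have inner: "(\<integral>h. ?k p h \<partial>lborel) = complex_of_real ((cmod (\<integral>x. cis (p \<bullet> x) * f x \<partial>lborel))\<^sup>2 * gauss (t *\<^sub>R p))" for p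
    unfolding of_real_mult cmod_fourier_square by simp
  from lborel_pair.integrable_fst[OF int]
  show "integrable lborel (\<lambda>p. (cmod (\<integral>x. cis (p \<bullet> x) * f x \<partial>lborel))\<^sup>2 * gauss (t *\<^sub>R p))"
    unfolding inner by (simp only: complex_of_real_integrable_eq)
  have scale: "(\<integral>p. cis (p \<bullet> h) * complex_of_real (gauss (t *\<^sub>R p)) \<partial>lborel)
     = complex_of_real (exp (- (norm (h /\<^sub>R t))\<^sup>2 / 2)) / t ^ DIM('a)" for h :: 'a
  proof -
    have "complex_of_real (exp (- (norm (h /\<^sub>R t))\<^sup>2 / 2)) = (\<integral>p. cis ((h /\<^sub>R t) \<bullet> p) * complex_of_real (gauss p) \<partial>lborel)"
      by (rule fourier_gauss(2)[symmetric])
    also have "\<dots> = t ^ DIM('a) *\<^sub>R (\<integral>p. cis ((h /\<^sub>R t) \<bullet> (t *\<^sub>R p)) * complex_of_real (gauss (t *\<^sub>R p)) \<partial>lborel)"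
      using t by (subst lborel_scaleR(2)[of _ t]) auto
    also have "(\<lambda>p. (h /\<^sub>R t) \<bullet> (t *\<^sub>R p)) = (\<lambda>p. p \<bullet> h)"
      using t by (auto simp: inner_commute)
    finally show ?thesis using t
      by (simp add: scaleR_conv_of_real)
  qed
  have "complex_of_real (\<integral>p. (cmod (\<integral>x. cis (p \<bullet> x) * f x \<partial>lborel))\<^sup>2 * gauss (t *\<^sub>R p) \<partial>lborel)
     = (\<integral>p. \<integral>h. ?k p h \<partial>lborel \<partial>lborel)"
    unfolding inner integral_complex_of_real ..
  also have "\<dots> = (\<integral>h. \<integral>p. ?k p h \<partial>lborel \<partial>lborel)"
    by (rule lborel_pair.Fubini_integral[OF int, symmetric])
  also have "\<dots> = (\<integral>h. autocorr f h * (complex_of_real (exp (- (norm (h /\<^sub>R t))\<^sup>2 / 2)) / t ^ DIM('a)) \<partial>lborel)"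
    unfolding scale[symmetric] by (intro Bochner_Integration.integral_cong refl) (simp add: mult_ac flip: integral_mult_right_zero)
  also have "\<dots> = (\<integral>z. autocorr f (t *\<^sub>R z) * complex_of_real (exp (- (norm z)\<^sup>2 / 2)) \<partial>lborel)"
    using t by (subst lborel_scaleR(2)[of _ t]) (auto simp: scaleR_conv_of_real)
  finally show "complex_of_real (\<integral>p. (cmod (\<integral>x. cis (p \<bullet> x) * f x \<partial>lborel))\<^sup>2 * gauss (t *\<^sub>R p) \<partial>lborel)
       = (\<integral>z. autocorr f (t *\<^sub>R z) * complex_of_real (exp (- (norm z)\<^sup>2 / 2)) \<partial>lborel)" .
qed

text \<open>
  As \<open>t\<close> decreases to \<open>0\<close>, the weights \<open>gauss (t *\<^sub>R p)\<close> increase to a constant, so the weighted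
  integrals of the squared modulus converge monotonically. By \<open>fourier_gauss_weighted\<close> and the
  continuity of \<open>autocorr f\<close> at \<open>0\<close> their limit is \<open>autocorr f 0\<close> times a Gaussian integral.
\<close>

theorem Plancherel:
  "has_bochner_integral lborel (\<lambda>p. (cmod (\<integral>x. cis (p \<bullet> x) * f x \<partial>lborel))\<^sup>2)
     ((2 * pi) ^ DIM('a) * (\<integral>x. (cmod (f x))\<^sup>2 \<partial>lborel))"
proof -
  let ?E = "\<integral>x. (cmod (f x))\<^sup>2 \<partial>lborel"
  define F2 where "F2 = (\<lambda>p. (cmod (\<integral>x. cis (p \<bullet> x) * f x \<partial>lborel))\<^sup>2)"
  define S where "S = sqrt (2 * pi) ^ DIM('a)"
  have "0 < S" by (simp add: S_def)
  have gS: "gauss z = exp (- (norm z)\<^sup>2 / 2) / S" for z :: 'a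
    by (simp add: gauss_eq S_def)
  have exp_int: "integrable lborel (\<lambda>z::'a. exp (- (norm z)\<^sup>2 / 2))"
    using integrable_mult_right[OF integrable_gauss[where 'a='a], of S] \<open>0 < S\<close> by (simp add: gS)
  have exp_eq: "(\<integral>z. exp (- (norm (z::'a))\<^sup>2 / 2) \<partial>lborel) = S"
    using integral_gauss[where 'a='a] \<open>0 < S\<close> by (simp add: gS[abs_def])
  define t where "t = (\<lambda>n. 1 / real (Suc n))"
  have t: "0 < t n" for n by (simp add: t_def)
  have t0: "t \<longlonglongrightarrow> 0" unfolding t_def by (rule LIMSEQ_inverse_real_of_nat[unfolded inverse_eq_divide])
  have F2_meas: "F2 \<in> borel_measurable lborel"
    unfolding F2_def by (intro borel_measurable_power borel_measurable_norm lborel.borel_measurable_lebesgue_integral) measurable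
  \<comment> \<open>Dominated convergence on the side of \<open>autocorr f\<close>, monotone convergence on the Fourier side.\<close>
  have lim: "(\<lambda>n. \<integral>z. autocorr f (t n *\<^sub>R z) * complex_of_real (exp (- (norm z)\<^sup>2 / 2)) \<partial>lborel)
      \<longlonglongrightarrow> (\<integral>z. autocorr f 0 * complex_of_real (exp (- (norm (z::'a))\<^sup>2 / 2)) \<partial>lborel)"
  proof (rule integral_dominated_convergence[where w="\<lambda>z. ?E * exp (- (norm z)\<^sup>2 / 2)"])
    show "AE z in lborel. (\<lambda>n. autocorr f (t n *\<^sub>R z) * complex_of_real (exp (- (norm z)\<^sup>2 / 2)))
        \<longlonglongrightarrow> autocorr f 0 * complex_of_real (exp (- (norm z)\<^sup>2 / 2))"
    proof (intro AE_I2 tendsto_intros autocorr_tendsto)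
      show "(\<lambda>n. t n *\<^sub>R z) \<longlonglongrightarrow> 0" for z :: 'a
        using tendsto_scaleR[OF t0 tendsto_const[of z]] by simp
    qed
    show "AE z in lborel. norm (autocorr f (t n *\<^sub>R z) * complex_of_real (exp (- (norm z)\<^sup>2 / 2)))
        \<le> ?E * exp (- (norm z)\<^sup>2 / 2)" for n
      by (intro AE_I2) (auto simp: norm_mult intro!: mult_right_mono autocorr_bound)
  qed (use exp_int in auto)
  also have "(\<integral>z. autocorr f 0 * complex_of_real (exp (- (norm (z::'a))\<^sup>2 / 2)) \<partial>lborel) = complex_of_real (?E * S)"
    by (simp only: autocorr_0 integral_mult_right_zero integral_complex_of_real exp_eq of_real_mult)
  finally have "(\<lambda>n. complex_of_real (\<integral>p. F2 p * gauss (t n *\<^sub>R p) \<partial>lborel)) \<longlonglongrightarrow> complex_of_real (?E * S)"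
    unfolding F2_def fourier_gauss_weighted(2)[OF t] .
  then have lim': "(\<lambda>n. \<integral>p. F2 p * gauss (t n *\<^sub>R p) \<partial>lborel) \<longlonglongrightarrow> ?E * S"
    by (simp only: tendsto_of_real_iff)
  have "has_bochner_integral lborel (\<lambda>p. F2 p / S) (?E * S)"
  proof (rule has_bochner_integral_monotone_convergence[OF _ _ _ lim'])
    show "integrable lborel (\<lambda>p. F2 p * gauss (t n *\<^sub>R p))" for n
      unfolding F2_def by (rule fourier_gauss_weighted(1)[OF t])
    show "AE p in lborel. mono (\<lambda>n. F2 p * gauss (t n *\<^sub>R p))"
    proof (intro AE_I2 monoI)
      fix p :: 'a and m n :: nat assume "m \<le> n"
      then have "t n \<le> t m" by (auto simp: t_def field_simps)
      then have "norm (t n *\<^sub>R p) \<le> norm (t m *\<^sub>R p)"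
        using t[of n] t[of m] by (auto intro!: mult_right_mono)
      then have "gauss (t m *\<^sub>R p) \<le> gauss (t n *\<^sub>R p)"
        using \<open>0 < S\<close> unfolding gS by (intro divide_right_mono) (auto intro: power_mono)
      then show "F2 p * gauss (t m *\<^sub>R p) \<le> F2 p * gauss (t n *\<^sub>R p)"
        by (intro mult_left_mono) (auto simp: F2_def)
    qed
    show "AE p in lborel. (\<lambda>n. F2 p * gauss (t n *\<^sub>R p)) \<longlonglongrightarrow> F2 p / S"
    proof (rule AE_I2)
      fix p :: 'a
      have "(\<lambda>n. F2 p * (exp (- (norm (t n *\<^sub>R p))\<^sup>2 / 2) / S)) \<longlonglongrightarrow> F2 p * (exp (- (norm (0 *\<^sub>R p))\<^sup>2 / 2) / S)"
        using \<open>0 < S\<close> by (intro tendsto_intros t0) auto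
      then show "(\<lambda>n. F2 p * gauss (t n *\<^sub>R p)) \<longlonglongrightarrow> F2 p / S"
        unfolding gS by simp
    qed
  qed (use F2_meas in auto)
  then have "has_bochner_integral lborel (\<lambda>p. S * (F2 p / S)) (S * (?E * S))"
    by (rule has_bochner_integral_mult_right)
  moreover have "S * S = (sqrt (2 * pi) * sqrt (2 * pi)) ^ DIM('a)"
    by (simp only: S_def power_mult_distrib)
  then have "S * (?E * S) = (2 * pi) ^ DIM('a) * ?E"
    by simp
  ultimately show ?thesis
    using \<open>0 < S\<close> by (simp add: F2_def)
qed

end

section \<open>Fourier inversion for square-integrable functions\<close>

lemma fourier_measurable [measurable]:
  fixes f :: "'a::euclidean_space \<Rightarrow> complex"
  assumes [measurable]: "f \<in> borel_measurable borel"
  shows "(\<lambda>p. \<integral>x. cis (p \<bullet> x) * f x \<partial>lborel) \<in> borel_measurable borel"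
proof -
  have "(\<lambda>p. \<integral>x. cis (p \<bullet> x) * f x \<partial>lborel) \<in> borel_measurable lborel"
    by (intro lborel.borel_measurable_lebesgue_integral) measurable
  then show ?thesis by simp
qed

lemma fourier_bound:
  fixes f :: "'a::euclidean_space \<Rightarrow> complex"
  assumes "integrable lborel f"
  shows "cmod (\<integral>x. cis (p \<bullet> x) * f x \<partial>lborel) \<le> (\<integral>x. cmod (f x) \<partial>lborel)"
  using integral_norm_bound[of lborel "\<lambda>x. cis (p \<bullet> x) * f x"] by (simp add: norm_mult)

lemma integrable_bounded_on_ball:
  fixes h :: "'a::euclidean_space \<Rightarrow> 'b::{banach, second_countable_topology}"
  assumes [measurable]: "h \<in> borel_measurable borel" and le: "\<And>p. norm (h p) \<le> C"
  shows "integrable lborel (\<lambda>p. indicator (ball 0 R) p *\<^sub>R h p)"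
proof (rule Bochner_Integration.integrable_bound)
  show "integrable lborel (\<lambda>p::'a. C * indicator (ball 0 R) p)"
    using emeasure_lborel_ball_finite[of "0::'a" R]
    by (intro integrable_mult_right integrable_real_indicator) auto
  have [measurable]: "ball (0::'a) R \<in> sets borel" by auto
  show "(\<lambda>p. indicator (ball 0 R) p *\<^sub>R h p) \<in> borel_measurable lborel" by simp
  show "AE p in lborel. norm (indicator (ball 0 R) p *\<^sub>R h p) \<le> norm (C * indicator (ball 0 R) p)"
    using order_trans[OF le abs_ge_self] by (auto simp: indicator_def)
qed

definition fourier_partial :: "('a::euclidean_space \<Rightarrow> complex) \<Rightarrow> real \<Rightarrow> 'a \<Rightarrow> complex" where
  "fourier_partial f R q = complex_of_real (1 / (2 * pi) ^ DIM('a)) *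
     (\<integral>p. indicator (ball 0 R) p *\<^sub>R (cis (- (p \<bullet> q)) * (\<integral>x. cis (p \<bullet> x) * f x \<partial>lborel)) \<partial>lborel)"

context
  fixes f :: "'a::euclidean_space \<Rightarrow> complex"
  assumes f [measurable]: "f \<in> borel_measurable borel"
    and f1: "integrable lborel f"
    and f2: "integrable lborel (\<lambda>x. (cmod (f x))\<^sup>2)"
begin

private definition "F p = (\<integral>x. cis (p \<bullet> x) * f x \<partial>lborel)"
private definition "F_ball R p = indicator (ball 0 R) p *\<^sub>R F p"
private definition "energy R = (\<integral>p. (cmod (F_ball R p))\<^sup>2 \<partial>lborel)"

private lemma F_meas [measurable]: "F \<in> borel_measurable borel"
  unfolding F_def[abs_def] by measurable

private lemma F_ball_measurable [measurable]: "F_ball R \<in> borel_measurable borel"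
proof -
  have [measurable]: "ball (0::'a) R \<in> sets borel" by auto
  show ?thesis unfolding F_ball_def[abs_def] by measurable
qed

private lemma F_bound: "cmod (F p) \<le> (\<integral>x. cmod (f x) \<partial>lborel)"
  unfolding F_def by (rule fourier_bound[OF f1])

private lemma F_ball_integrable: "integrable lborel (F_ball R)"
  unfolding F_ball_def[abs_def] by (rule integrable_bounded_on_ball[OF F_meas F_bound])

private lemma F_ball_square_integrable: "integrable lborel (\<lambda>p. (cmod (F_ball R p))\<^sup>2)"
proof -
  have "integrable lborel (\<lambda>p. indicator (ball 0 R) p *\<^sub>R (cmod (F p))\<^sup>2)"
    by (rule integrable_bounded_on_ball[where C="(\<integral>x. cmod (f x) \<partial>lborel)\<^sup>2"])
       (auto intro!: power_mono F_bound)
  also have "(\<lambda>p. indicator (ball 0 R) p *\<^sub>R (cmod (F p))\<^sup>2) = (\<lambda>p. (cmod (F_ball R p))\<^sup>2)"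
    by (auto simp: F_ball_def indicator_def)
  finally show ?thesis .
qed

private lemma fourier_partial_eq:
  "fourier_partial f R q = complex_of_real (1 / (2 * pi) ^ DIM('a)) * (\<integral>p. cis (((-1) *\<^sub>R q) \<bullet> p) * F_ball R p \<partial>lborel)"
  unfolding fourier_partial_def F_def[symmetric] F_ball_def by (simp add: inner_commute)

lemma fourier_partial_measurable [measurable]: "fourier_partial f R \<in> borel_measurable borel"
proof -
  have "(\<lambda>q. \<integral>p. cis (((-1) *\<^sub>R q) \<bullet> p) * F_ball R p \<partial>lborel) \<in> borel_measurable borel"
    by (rule measurable_compose[OF _ fourier_measurable[OF F_ball_measurable]]) measurable
  then show ?thesis
    unfolding fourier_partial_eq[abs_def] by measurable
qed

text \<open>
  The truncated transform \<open>F_ball R\<close> is bounded with bounded support, so Plancherel's theorem applies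
  to it as well.
\<close>

private lemma fourier_partial_energy:
  "has_bochner_integral lborel (\<lambda>q. (cmod (fourier_partial f R q))\<^sup>2) (energy R / (2 * pi) ^ DIM('a))"
proof -
  let ?G = "\<lambda>q. (cmod (\<integral>p. cis (q \<bullet> p) * F_ball R p \<partial>lborel))\<^sup>2"
  have P: "has_bochner_integral lborel ?G ((2 * pi) ^ DIM('a) * energy R)"
    unfolding energy_def by (rule Plancherel[OF F_ball_measurable F_ball_integrable F_ball_square_integrable])
  then have int: "integrable lborel ?G" and eq: "(\<integral>q. ?G q \<partial>lborel) = (2 * pi) ^ DIM('a) * energy R"
    by (auto simp: has_bochner_integral_iff)
  have G_meas: "?G \<in> borel_measurable borel"
    using borel_measurable_integrable[OF int] by simp
  have "integrable lborel (\<lambda>q. ?G ((-1) *\<^sub>R q))" "(\<integral>q. ?G ((-1) *\<^sub>R q) \<partial>lborel) = (2 * pi) ^ DIM('a) * energy R"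
    using lborel_scaleR(1)[OF G_meas, of "-1"] lborel_scaleR(2)[OF G_meas, of "-1"] int eq by simp_all
  then have "has_bochner_integral lborel (\<lambda>q. ?G ((-1) *\<^sub>R q)) ((2 * pi) ^ DIM('a) * energy R)"
    by (simp add: has_bochner_integral_iff)
  then have "has_bochner_integral lborel (\<lambda>q. (1 / (2 * pi) ^ DIM('a))\<^sup>2 * ?G ((-1) *\<^sub>R q)) ((1 / (2 * pi) ^ DIM('a))\<^sup>2 * ((2 * pi) ^ DIM('a) * energy R))"
    by (rule has_bochner_integral_mult_right)
  moreover have "(1 / (2 * pi) ^ DIM('a))\<^sup>2 * ?G ((-1) *\<^sub>R q) = (cmod (fourier_partial f R q))\<^sup>2" for q
  proof -
    have "cmod (fourier_partial f R q) = 1 / (2 * pi) ^ DIM('a) * cmod (\<integral>p. cis (((-1) *\<^sub>R q) \<bullet> p) * F_ball R p \<partial>lborel)"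
      unfolding fourier_partial_eq by (simp add: norm_mult norm_divide norm_power del: of_real_power of_real_mult)
    then show ?thesis by (simp only: power_mult_distrib)
  qed
  moreover have "(1 / (2 * pi) ^ DIM('a))\<^sup>2 * ((2 * pi) ^ DIM('a) * energy R) = energy R / (2 * pi) ^ DIM('a)"
    by (simp add: power2_eq_square)
  ultimately show ?thesis by simp
qed

text \<open>
  Exchanging the integrals moves the inverse transform from \<open>F_ball R\<close> to \<open>f\<close>, where it becomes the
  complex conjugate of \<open>F\<close>.
\<close>

private lemma fourier_partial_cross:
  "has_bochner_integral lborel (\<lambda>q. fourier_partial f R q * cnj (f q)) (complex_of_real (energy R / (2 * pi) ^ DIM('a)))"
proof -
  let ?k = "\<lambda>q p. cis (- (p \<bullet> q)) * F_ball R p * cnj (f q)"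
  have int: "integrable (lborel \<Otimes>\<^sub>M lborel) (\<lambda>(q, p). ?k q p)"
  proof (rule lborel_pair.Fubini_integrable)
    show "integrable lborel (\<lambda>q. \<integral>p. norm (case (q, p) of (q, p) \<Rightarrow> ?k q p) \<partial>lborel)"
      using f1 F_ball_integrable by (simp add: norm_mult)
    have "integrable lborel (\<lambda>p. cis (- (p \<bullet> q)) * F_ball R p)" for q
      by (rule Bochner_Integration.integrable_bound[OF F_ball_integrable]) (auto simp: norm_mult)
    then show "AE q in lborel. integrable lborel (\<lambda>p. case (q, p) of (q, p) \<Rightarrow> ?k q p)"
      by simp
  qed measurable
  have inner: "(\<integral>p. ?k q p \<partial>lborel) = (\<integral>p. cis (((-1) *\<^sub>R q) \<bullet> p) * F_ball R p \<partial>lborel) * cnj (f q)" for q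
    by (simp add: inner_commute)
  have cnj_F: "(\<integral>q. cis (- (p \<bullet> q)) * cnj (f q) \<partial>lborel) = cnj (F p)" for p
    unfolding F_def Bochner_Integration.integral_cnj[symmetric] by (simp add: cis_cnj)
  have "(\<integral>q. \<integral>p. ?k q p \<partial>lborel \<partial>lborel) = (\<integral>p. \<integral>q. ?k q p \<partial>lborel \<partial>lborel)"
    by (rule lborel_pair.Fubini_integral[OF int, symmetric])
  also have "\<dots> = (\<integral>p. complex_of_real ((cmod (F_ball R p))\<^sup>2) \<partial>lborel)"
  proof (rule Bochner_Integration.integral_cong[OF refl])
    fix p
    have "(\<integral>q. ?k q p \<partial>lborel) = (\<integral>q. F_ball R p * (cis (- (p \<bullet> q)) * cnj (f q)) \<partial>lborel)"
      by (intro Bochner_Integration.integral_cong refl) (simp only: mult_ac)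
    also have "\<dots> = F_ball R p * cnj (F p)"
      by (simp only: integral_mult_right_zero cnj_F)
    also have "\<dots> = F_ball R p * cnj (F_ball R p)"
      by (simp add: F_ball_def indicator_def)
    finally show "(\<integral>q. ?k q p \<partial>lborel) = complex_of_real ((cmod (F_ball R p))\<^sup>2)"
      by (simp only: complex_norm_square)
  qed
  also have "\<dots> = complex_of_real (energy R)"
    unfolding energy_def by (rule integral_complex_of_real)
  finally have eq: "(\<integral>q. \<integral>p. ?k q p \<partial>lborel \<partial>lborel) = complex_of_real (energy R)" .
  have "has_bochner_integral lborel (\<lambda>q. \<integral>p. ?k q p \<partial>lborel) (complex_of_real (energy R))"
    using lborel_pair.integrable_fst[OF int] eq by (simp add: has_bochner_integral_iff)
  then have "has_bochner_integral lborel (\<lambda>q. complex_of_real (1 / (2 * pi) ^ DIM('a)) * (\<integral>p. ?k q p \<partial>lborel)) (complex_of_real (1 / (2 * pi) ^ DIM('a)) * complex_of_real (energy R))"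
    by (rule has_bochner_integral_mult_right)
  then show ?thesis
    unfolding inner fourier_partial_eq by (simp add: mult.assoc)
qed

lemma fourier_partial_L2: "integrable lborel (\<lambda>q. (cmod (fourier_partial f R q))\<^sup>2)"
  using fourier_partial_energy by (simp add: has_bochner_integral_iff)

text \<open>
  Expanding the square, the partial integral contributes its energy once with a positive sign, and the
  cross terms contribute the same energy twice with a negative sign.
\<close>

private lemma fourier_partial_error:
  "(\<integral>q. (cmod (fourier_partial f R q - f q))\<^sup>2 \<partial>lborel) = (\<integral>q. (cmod (f q))\<^sup>2 \<partial>lborel) - energy R / (2 * pi) ^ DIM('a)"
proof -
  have expand: "(cmod (fourier_partial f R q - f q))\<^sup>2
      = (cmod (fourier_partial f R q))\<^sup>2 - 2 * Re (fourier_partial f R q * cnj (f q)) + (cmod (f q))\<^sup>2" for q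
    unfolding cmod_power2 by (simp add: power2_eq_square algebra_simps)
  have "has_bochner_integral lborel (\<lambda>q. Re (fourier_partial f R q * cnj (f q))) (Re (complex_of_real (energy R / (2 * pi) ^ DIM('a))))"
    by (rule has_bochner_integral_bounded_linear[OF bounded_linear_Re fourier_partial_cross])
  then have "has_bochner_integral lborel
      (\<lambda>q. (cmod (fourier_partial f R q))\<^sup>2 - 2 * Re (fourier_partial f R q * cnj (f q)) + (cmod (f q))\<^sup>2)
      (energy R / (2 * pi) ^ DIM('a) - 2 * Re (complex_of_real (energy R / (2 * pi) ^ DIM('a))) + (\<integral>q. (cmod (f q))\<^sup>2 \<partial>lborel))"
    by (intro has_bochner_integral_add has_bochner_integral_diff fourier_partial_energy has_bochner_integral_mult_right
          has_bochner_integral_integrable f2)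
  then show ?thesis
    unfolding expand by (simp add: has_bochner_integral_iff)
qed

text \<open>
  As \<open>R\<close> grows, the energy in the ball of radius \<open>R\<close> exhausts the energy of the whole transform. By
  Plancherel's theorem this is the squared norm of \<open>f\<close>, up to the factor in the error formula, so
  that the error tends to \<open>0\<close>.
\<close>

theorem fourier_inversion_L2:
  "((\<lambda>R. \<integral>q. (cmod (fourier_partial f R q - f q))\<^sup>2 \<partial>lborel) \<longlongrightarrow> 0) at_top"
proof -
  let ?E = "\<integral>q. (cmod (f q))\<^sup>2 \<partial>lborel"
  have P: "has_bochner_integral lborel (\<lambda>p. (cmod (F p))\<^sup>2) ((2 * pi) ^ DIM('a) * ?E)"
    unfolding F_def by (rule Plancherel[OF f f1 f2])
  then have F2: "integrable lborel (\<lambda>p. (cmod (F p))\<^sup>2)" and eq: "(\<integral>p. (cmod (F p))\<^sup>2 \<partial>lborel) = (2 * pi) ^ DIM('a) * ?E"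
    by (auto simp: has_bochner_integral_iff)
  have "(energy \<longlongrightarrow> (\<integral>p. (cmod (F p))\<^sup>2 \<partial>lborel)) at_top"
    unfolding energy_def[abs_def]
  proof (rule integral_dominated_convergence_at_top[OF _ _ F2])
    show "AE p in lborel. ((\<lambda>R. (cmod (F_ball R p))\<^sup>2) \<longlongrightarrow> (cmod (F p))\<^sup>2) at_top"
    proof (rule AE_I2)
      fix p :: 'a
      have "\<forall>\<^sub>F R in at_top. (cmod (F_ball R p))\<^sup>2 = (cmod (F p))\<^sup>2"
        using eventually_gt_at_top[of "norm p"] by eventually_elim (simp add: F_ball_def)
      then show "((\<lambda>R. (cmod (F_ball R p))\<^sup>2) \<longlongrightarrow> (cmod (F p))\<^sup>2) at_top"
        by (rule tendsto_eventually)
    qed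
    show "\<forall>\<^sub>F R in at_top. AE p in lborel. norm ((cmod (F_ball R p))\<^sup>2) \<le> (cmod (F p))\<^sup>2"
      by (intro always_eventually allI AE_I2) (simp add: F_ball_def indicator_def)
  qed auto
  then have "((\<lambda>R. ?E - energy R / (2 * pi) ^ DIM('a)) \<longlongrightarrow> ?E - ((2 * pi) ^ DIM('a) * ?E) / (2 * pi) ^ DIM('a)) at_top"
    unfolding eq by (intro tendsto_intros) auto
  then show ?thesis
    unfolding fourier_partial_error by simp
qed

end

section \<open>Polar coordinates\<close>

lemma nn_integral_radial_weight:
  fixes m :: real
  assumes "0 < m" "0 < d"
  shows "(\<integral>\<^sup>+s. ennreal (indicator {0<..<m} s * s ^ (d - 1)) \<partial>lborel) = ennreal (m ^ d / d)"
proof -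
  have "(\<integral>\<^sup>+s. ennreal (indicator {0<..<m} s * s ^ (d - 1)) \<partial>lborel)
      = (\<integral>\<^sup>+s. ennreal (s ^ (d - 1)) * indicator {0..m} s \<partial>lborel)"
  proof (rule nn_integral_cong_AE)
    have "AE s in lborel. s \<noteq> 0" "AE s in lborel. s \<noteq> m"
      by (rule AE_lborel_singleton)+
    then show "AE s in lborel. ennreal (indicator {0<..<m} s * s ^ (d - 1)) = ennreal (s ^ (d - 1)) * indicator {0..m} s"
      by eventually_elim (auto simp: indicator_def)
  qed
  also have "\<dots> = ennreal (m ^ d / d - 0 ^ d / d)"
  proof (rule nn_integral_FTC_Icc)
    show "((\<lambda>x. x ^ d / real d) has_real_derivative x ^ (d - 1)) (at x)" for x
      using \<open>0 < d\<close> by (auto intro!: derivative_eq_intros)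
  qed (use assms in auto)
  finally show ?thesis using \<open>0 < d\<close> by (simp add: zero_power)
qed

definition cone_upto :: "real \<Rightarrow> 'a::euclidean_space set \<Rightarrow> 'a set" where
  "cone_upto m A = {q. 0 < norm q \<and> norm q < m \<and> sgn q \<in> A}"

lemma borel_measurable_sgn [measurable]: "(sgn :: 'a::euclidean_space \<Rightarrow> 'a) \<in> borel_measurable borel"
proof -
  have "(\<lambda>q::'a. q /\<^sub>R norm q) \<in> borel_measurable borel" by measurable
  then show ?thesis by (simp add: sgn_div_norm[abs_def])
qed

lemma cone_upto_measurable [measurable]:
  assumes [measurable]: "A \<in> sets borel"
  shows "cone_upto m A \<in> sets borel"
  unfolding cone_upto_def by measurable

lemma emeasure_cone_upto:
  fixes A :: "'a::euclidean_space set"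
  assumes [measurable]: "A \<in> sets borel" and "0 < m"
  shows "emeasure lborel (cone_upto m A) = ennreal (m ^ DIM('a)) * emeasure lborel (cone_upto 1 A)"
proof -
  have "emeasure lborel (cone_upto m A) = emeasure (density (distr lborel borel (\<lambda>x::'a. 0 + m *\<^sub>R x)) (\<lambda>_. \<bar>m\<bar> ^ DIM('a))) (cone_upto m A)"
    using \<open>0 < m\<close> by (subst lborel_affine[of m 0]) auto
  also have "\<dots> = ennreal (m ^ DIM('a)) * emeasure lborel ((\<lambda>x. m *\<^sub>R x) -` cone_upto m A)"
    using \<open>0 < m\<close> by (simp add: emeasure_density nn_integral_cmult emeasure_distr)
  also have "(\<lambda>x. m *\<^sub>R x) -` cone_upto m A = cone_upto 1 A"
    using \<open>0 < m\<close> by (auto simp: cone_upto_def sgn_scaleR)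
  finally show ?thesis .
qed

lemma sgn_measurable_sphere:
  "sgn \<in> restrict_space lborel (ball 0 R - {0::'a::euclidean_space}) \<rightarrow>\<^sub>M restrict_space borel (sphere 0 1)"
  by (rule measurable_restrict_space2)
     (auto simp: space_restrict_space norm_sgn intro!: measurable_restrict_space1)

lemma emeasure_sphere_measure:
  fixes A :: "'a::euclidean_space set"
  assumes A: "A \<in> sets borel" "A \<subseteq> sphere 0 1"
  shows "emeasure sphere_measure A = of_nat DIM('a) * emeasure lborel (cone_upto 1 A)"
proof -
  have "A \<in> sets (restrict_space borel (sphere 0 1))"
    using A by (auto simp: sets_restrict_space_iff)
  then have "emeasure sphere_measure A = of_nat DIM('a) *
      emeasure (restrict_space lborel (ball 0 1 - {0})) (sgn -` A \<inter> space (restrict_space lborel (ball 0 1 - {0})))"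
    unfolding sphere_measure_def emeasure_scale_measure by (subst emeasure_distr[OF sgn_measurable_sphere]) auto
  also have "sgn -` A \<inter> space (restrict_space lborel (ball 0 1 - {0})) = cone_upto 1 A"
    by (auto simp: space_restrict_space cone_upto_def)
  also have "emeasure (restrict_space lborel (ball 0 1 - {0})) (cone_upto 1 A) = emeasure lborel (cone_upto 1 A)"
    by (rule emeasure_restrict_space) (auto simp: cone_upto_def)
  finally show ?thesis .
qed

lemma space_sphere_measure: "space (sphere_measure :: 'a::euclidean_space measure) = sphere 0 1"
  by (simp add: sphere_measure_def space_scale_measure space_restrict_space)

lemma sets_sphere_measure [measurable_cong]: "sets (sphere_measure :: 'a::euclidean_space measure) = sets (restrict_space borel (sphere 0 1))"
  by (simp add: sphere_measure_def)

lemma finite_sphere_measure: "finite_measure (sphere_measure :: 'a::euclidean_space measure)"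
proof
  have "emeasure lborel (cone_upto 1 (sphere (0::'a) 1)) \<le> emeasure lborel (ball (0::'a) 1)"
    by (rule emeasure_mono) (auto simp: cone_upto_def)
  also have "\<dots> < \<infinity>" by (rule emeasure_lborel_ball_finite)
  finally have "of_nat DIM('a) * emeasure lborel (cone_upto 1 (sphere (0::'a) 1)) < \<infinity>"
    unfolding ennreal_of_nat_eq_real_of_nat by (auto simp: ennreal_mult_less_top)
  then show "emeasure (sphere_measure :: 'a measure) (space sphere_measure) \<noteq> \<infinity>"
    by (subst space_sphere_measure, subst emeasure_sphere_measure) auto
qed

text \<open>
  The density \<open>s ^ (d - 1)\<close> is cut off at \<open>R\<close> so that the measure is finite.
\<close>

definition radial_measure :: "nat \<Rightarrow> real \<Rightarrow> real measure" where
  "radial_measure d R = density lborel (\<lambda>s. ennreal (indicator {0<..<R} s * s ^ (d - 1)))"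

lemma sets_radial_measure [simp, measurable_cong]: "sets (radial_measure d R) = sets borel"
  by (simp add: radial_measure_def)

lemma space_radial_measure [simp]: "space (radial_measure d R) = UNIV"
  by (simp add: radial_measure_def)

lemma emeasure_radial_measure_lessThan:
  assumes "0 < R" "0 < d"
  shows "emeasure (radial_measure d R) {..<b} = ennreal ((max 0 (min b R)) ^ d / d)"
proof -
  have "emeasure (radial_measure d R) {..<b} = (\<integral>\<^sup>+s. ennreal (indicator {0<..<min b R} s * s ^ (d - 1)) \<partial>lborel)"
    unfolding radial_measure_def
    by (subst emeasure_density) (auto intro!: nn_integral_cong simp: indicator_def)
  also have "\<dots> = ennreal ((max 0 (min b R)) ^ d / d)"
  proof (cases "0 < b")
    case True
    then show ?thesis using assms by (subst nn_integral_radial_weight) auto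
  next
    case False
    then have "{0<..<min b R} = {}" "max 0 (min b R) = 0" by auto
    then show ?thesis using \<open>0 < d\<close> by simp
  qed
  finally show ?thesis .
qed

lemma finite_radial_measure:
  assumes "0 < R" "0 < d"
  shows "finite_measure (radial_measure d R)"
proof
  have "emeasure (radial_measure d R) UNIV = (\<integral>\<^sup>+s. ennreal (indicator {0<..<R} s * s ^ (d - 1)) \<partial>lborel)"
    unfolding radial_measure_def by (subst emeasure_density) auto
  also have "\<dots> \<noteq> \<infinity>"
    using assms by (subst nn_integral_radial_weight) auto
  finally show "emeasure (radial_measure d R) (space (radial_measure d R)) \<noteq> \<infinity>" by simp
qed

lemma real_measure_eqI_lessThan:
  fixes M N :: "real measure"
  assumes sets: "sets M = sets borel" "sets N = sets borel"
    and fin: "\<And>b. emeasure M {..<b} \<noteq> \<infinity>"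
    and eq: "\<And>b. emeasure M {..<b} = emeasure N {..<b}"
  shows "M = N"
proof (rule measure_eqI_generator_eq)
  let ?E = "range (\<lambda>a::real. {..<a})"
  show "Int_stable ?E"
  proof (rule Int_stableI_image)
    show "\<exists>c\<in>UNIV. {..<a} \<inter> {..<b} = {..<c}" for a b :: real
      by (rule bexI[of _ "min a b"]) auto
  qed
  show "sets M = sigma_sets UNIV ?E" "sets N = sigma_sets UNIV ?E"
    unfolding sets borel_Iio by auto
  show "range (\<lambda>n::nat. {..<real n}) \<subseteq> ?E" by auto
  show "(\<Union>n::nat. {..<real n}) = UNIV" using reals_Archimedean2 by auto
qed (use fin eq in auto)

text \<open>
  By definition of the surface measure it is enough to compare both sides on rectangles. For a fixed
  set \<open>A\<close> of directions they are measures in the radius, and those agree on every \<open>{..<b}\<close> because the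
  volume of a truncated cone grows like the \<open>d\<close>-th power of its length.
\<close>

lemma polar_measure:
  fixes R :: real
  assumes "0 < R"
  shows "sphere_measure \<Otimes>\<^sub>M radial_measure DIM('a) R
    = distr (restrict_space lborel (ball 0 R - {0::'a::euclidean_space})) (restrict_space borel (sphere 0 1) \<Otimes>\<^sub>M borel) (\<lambda>q. (sgn q, norm q))"
    (is "_ = ?D")
proof (rule pair_measure_eqI)
  interpret S: finite_measure "sphere_measure :: 'a measure" by (rule finite_sphere_measure)
  interpret N: finite_measure "radial_measure DIM('a) R" by (rule finite_radial_measure) (use assms in auto)
  show "sigma_finite_measure (sphere_measure :: 'a measure)" "sigma_finite_measure (radial_measure DIM('a) R)"
    by unfold_locales
  show "sets (sphere_measure \<Otimes>\<^sub>M radial_measure DIM('a) R) = sets ?D"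
    by (simp cong: sets_pair_measure_cong add: sets_sphere_measure)
  have T: "(\<lambda>q. (sgn q, norm q)) \<in> restrict_space lborel (ball 0 R - {0::'a}) \<rightarrow>\<^sub>M restrict_space borel (sphere 0 1) \<Otimes>\<^sub>M borel"
    by (intro measurable_Pair sgn_measurable_sphere measurable_restrict_space1) auto
  fix A :: "'a set" and B
  assume "A \<in> sets sphere_measure" and "B \<in> sets (radial_measure DIM('a) R)"
  then have A[measurable]: "A \<in> sets borel" and A': "A \<in> sets (restrict_space borel (sphere 0 1))"
    and As: "A \<subseteq> sphere 0 1" and B: "B \<in> sets borel"
    by (auto simp: sets_sphere_measure sets_restrict_space_iff)
  let ?M = "scale_measure (emeasure sphere_measure A) (radial_measure DIM('a) R)"
  let ?M' = "distr (restrict_space lborel (cone_upto R A)) borel norm"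
  have norm_meas: "norm \<in> restrict_space lborel (cone_upto R A) \<rightarrow>\<^sub>M borel"
    by (intro measurable_restrict_space1) auto
  have fin: "emeasure sphere_measure A \<noteq> \<infinity>" by simp
  have "?M = ?M'"
  proof (rule real_measure_eqI_lessThan)
    fix b
    show "emeasure ?M {..<b} \<noteq> \<infinity>"
      using fin N.emeasure_finite by (simp add: ennreal_mult_eq_top_iff)
    have "emeasure ?M' {..<b} = emeasure lborel (norm -` {..<b} \<inter> cone_upto R A)"
      by (subst emeasure_distr[OF norm_meas]) (auto simp: space_restrict_space intro!: emeasure_restrict_space)
    also have "norm -` {..<b} \<inter> cone_upto R A = cone_upto (min b R) A"
      by (auto simp: cone_upto_def)
    also have "emeasure lborel (cone_upto (min b R) A) = ennreal ((max 0 (min b R)) ^ DIM('a)) * emeasure lborel (cone_upto 1 A)"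
    proof (cases "0 < b")
      case True
      then show ?thesis using \<open>0 < R\<close> by (subst emeasure_cone_upto) auto
    next
      case False
      then have "\<not> norm q < b" for q :: 'a using norm_ge_zero[of q] by linarith
      then have "cone_upto (min b R) A = {}" by (auto simp: cone_upto_def)
      then show ?thesis using False \<open>0 < R\<close> by auto
    qed
    also have "\<dots> = emeasure ?M {..<b}"
    proof -
      have "ennreal (max 0 (min b R) ^ DIM('a)) = of_nat DIM('a) * ennreal (max 0 (min b R) ^ DIM('a) / DIM('a))"
        by (simp add: ennreal_of_nat_eq_real_of_nat ennreal_mult[symmetric])
      then show ?thesis
        using \<open>0 < R\<close> by (simp add: emeasure_radial_measure_lessThan emeasure_sphere_measure[OF A As] mult_ac)
    qed
    finally show "emeasure ?M {..<b} = emeasure ?M' {..<b}" ..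
  qed auto
  then have "emeasure ?M B = emeasure ?M' B" by simp
  also have "\<dots> = emeasure lborel (norm -` B \<inter> cone_upto R A)"
    using B by (subst emeasure_distr[OF norm_meas]) (auto simp: space_restrict_space intro!: emeasure_restrict_space)
  also have "\<dots> = emeasure ?D (A \<times> B)"
  proof -
    have "A \<times> B \<in> sets (restrict_space borel (sphere 0 1) \<Otimes>\<^sub>M borel)"
      using A' B by auto
    then have "emeasure ?D (A \<times> B) = emeasure (restrict_space lborel (ball 0 R - {0})) ((\<lambda>q. (sgn q, norm q)) -` (A \<times> B) \<inter> (ball 0 R - {0}))"
      by (subst emeasure_distr[OF T]) (auto simp: space_restrict_space)
    also have "(\<lambda>q. (sgn q, norm q)) -` (A \<times> B) \<inter> (ball 0 R - {0}) = norm -` B \<inter> cone_upto R A"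
      by (auto simp: cone_upto_def)
    also have "emeasure (restrict_space lborel (ball 0 R - {0})) (norm -` B \<inter> cone_upto R A) = emeasure lborel (norm -` B \<inter> cone_upto R A)"
      by (rule emeasure_restrict_space) (auto simp: cone_upto_def)
    finally show ?thesis ..
  qed
  finally show "emeasure sphere_measure A * emeasure (radial_measure DIM('a) R) B = emeasure ?D (A \<times> B)"
    by simp
qed

theorem integral_polar:
  fixes h :: "'a::euclidean_space \<Rightarrow> complex"
  assumes h [measurable]: "h \<in> borel_measurable borel" and "0 < R"
    and int: "integrable lborel (\<lambda>q. indicator (ball 0 R) q *\<^sub>R h q)"
  shows "(\<integral>q. indicator (ball 0 R) q *\<^sub>R h q \<partial>lborel)
    = (LINT \<theta>|sphere_measure. LINT s|lebesgue_on {0..R}. h (s *\<^sub>R \<theta>) * complex_of_real (s ^ (DIM('a) - 1)))"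
proof -
  interpret S: finite_measure "sphere_measure :: 'a measure" by (rule finite_sphere_measure)
  interpret N: finite_measure "radial_measure DIM('a) R" by (rule finite_radial_measure) (use assms in auto)
  interpret SN: pair_sigma_finite "sphere_measure :: 'a measure" "radial_measure DIM('a) R" ..
  let ?B = "ball 0 R - {0::'a}"
  let ?T = "\<lambda>q::'a. (sgn q, norm q)"
  let ?P = "restrict_space borel (sphere 0 1) \<Otimes>\<^sub>M borel :: ('a \<times> real) measure"
  let ?H = "\<lambda>(\<theta>::'a, s). h (s *\<^sub>R \<theta>)"
  have T: "?T \<in> restrict_space lborel ?B \<rightarrow>\<^sub>M ?P"
    by (intro measurable_Pair sgn_measurable_sphere measurable_restrict_space1) auto
  have fst_meas: "fst \<in> ?P \<rightarrow>\<^sub>M borel"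
    by (rule measurable_compose[OF measurable_fst]) (auto intro: measurable_restrict_space1)
  have H: "?H \<in> borel_measurable ?P"
    unfolding case_prod_beta by (intro measurable_compose[OF _ h] borel_measurable_scaleR fst_meas measurable_snd)
  have HT: "?H (?T q) = h q" for q
    by (cases "q = 0") (auto simp: sgn_div_norm)
  have not0: "AE q in lborel. q \<noteq> (0::'a)" by (rule AE_lborel_singleton)
  have [measurable]: "?B \<in> sets borel" "ball (0::'a) R \<in> sets borel" by auto
  have Bset: "?B \<inter> space lborel \<in> sets lborel" by auto
  \<comment> \<open>The direction \<open>sgn q\<close> makes sense away from the origin only, which is a null set.\<close>
  have ae: "AE q in lborel. indicator ?B q *\<^sub>R h q = indicator (ball 0 R) q *\<^sub>R h q"
    using not0 by eventually_elim (auto simp: indicator_def)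
  have "integrable lborel (\<lambda>q. indicator ?B q *\<^sub>R h q)"
    using int by (subst integrable_cong_AE[OF _ _ ae]) auto
  then have "integrable (restrict_space lborel ?B) h"
    using integrable_restrict_space[OF Bset, of h] by simp
  then have "integrable (distr (restrict_space lborel ?B) ?P ?T) ?H"
    by (subst integrable_distr_eq[OF T H]) (simp only: HT)
  then have Hint: "integrable (sphere_measure \<Otimes>\<^sub>M radial_measure DIM('a) R) ?H"
    unfolding polar_measure[OF \<open>0 < R\<close>] .
  have "(\<integral>q. indicator (ball 0 R) q *\<^sub>R h q \<partial>lborel) = (\<integral>q. indicator ?B q *\<^sub>R h q \<partial>lborel)"
    by (rule integral_cong_AE[symmetric, OF _ _ ae]) auto
  also have "\<dots> = integral\<^sup>L (restrict_space lborel ?B) h"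
    using integral_restrict_space[OF Bset, of h] by simp
  also have "\<dots> = integral\<^sup>L (distr (restrict_space lborel ?B) ?P ?T) ?H"
    unfolding integral_distr[OF T H] by (simp only: HT)
  also have "\<dots> = integral\<^sup>L (sphere_measure \<Otimes>\<^sub>M radial_measure DIM('a) R) ?H"
    unfolding polar_measure[OF \<open>0 < R\<close>] ..
  also have "\<dots> = (LINT \<theta>|sphere_measure. LINT s|radial_measure DIM('a) R. h (s *\<^sub>R \<theta>))"
    using SN.integral_fst'[OF Hint] by simp
  also have "\<dots> = (LINT \<theta>|sphere_measure. LINT s|lebesgue_on {0..R}. h (s *\<^sub>R \<theta>) * complex_of_real (s ^ (DIM('a) - 1)))"
  proof (rule Bochner_Integration.integral_cong[OF refl])
    fix \<theta> :: 'a
    let ?w = "\<lambda>s::real. s ^ (DIM('a) - 1)"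
    have "(LINT s|radial_measure DIM('a) R. h (s *\<^sub>R \<theta>)) = (\<integral>s. (indicator {0<..<R} s * ?w s) *\<^sub>R h (s *\<^sub>R \<theta>) \<partial>lborel)"
      unfolding radial_measure_def by (rule integral_density) (auto simp: indicator_def)
    also have "\<dots> = (\<integral>s. indicator {0..R} s *\<^sub>R (h (s *\<^sub>R \<theta>) * complex_of_real (?w s)) \<partial>lborel)"
    proof (rule integral_cong_AE)
      have "AE s in lborel. s \<noteq> 0" "AE s in lborel. s \<noteq> R"
        by (rule AE_lborel_singleton)+
      then show "AE s in lborel. (indicator {0<..<R} s * ?w s) *\<^sub>R h (s *\<^sub>R \<theta>) = indicator {0..R} s *\<^sub>R (h (s *\<^sub>R \<theta>) * complex_of_real (?w s))"
        by eventually_elim (auto simp: indicator_def scaleR_conv_of_real)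
    qed auto
    also have "\<dots> = (\<integral>s. indicator {0..R} s *\<^sub>R (h (s *\<^sub>R \<theta>) * complex_of_real (?w s)) \<partial>lebesgue)"
      by (rule integral_completion[symmetric]) auto
    also have "\<dots> = (LINT s|lebesgue_on {0..R}. h (s *\<^sub>R \<theta>) * complex_of_real (?w s))"
      by (rule integral_restrict_space[symmetric]) auto
    finally show "(LINT s|radial_measure DIM('a) R. h (s *\<^sub>R \<theta>)) = (LINT s|lebesgue_on {0..R}. h (s *\<^sub>R \<theta>) * complex_of_real (?w s))" .
  qed
  finally show ?thesis .
qed

section \<open>Integrals over hyperplanes\<close>

text \<open>
  The Radon transform is described by its exponential integrals, which determine it almost everywhere:
  no parametrisation of the hyperplanes enters the rest of the argument.
\<close>

definition has_plane_integrals :: "('a::euclidean_space \<Rightarrow> complex) \<Rightarrow> 'a \<Rightarrow> (real \<Rightarrow> complex) \<Rightarrow> bool" where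
  "has_plane_integrals V \<theta> u \<longleftrightarrow> u \<in> borel_measurable borel \<and> (\<forall>t. t \<notin> {-1..1} \<longrightarrow> u t = 0) \<and>
     integrable lborel (\<lambda>t. (cmod (u t))\<^sup>2) \<and>
     (\<forall>s. (\<integral>t. cis (s * t) * u t \<partial>lborel) = (\<integral>q. cis (s * (\<theta> \<bullet> q)) * V q \<partial>lborel))"

lemma has_plane_integrals_uminus:
  assumes "has_plane_integrals V (- \<theta>) u"
  shows "has_plane_integrals V \<theta> (\<lambda>t. u (- t))"
proof -
  have [measurable]: "u \<in> borel_measurable borel"
    and supp: "\<And>t. t \<notin> {-1..1} \<Longrightarrow> u t = 0"
    and u2: "integrable lborel (\<lambda>t. (cmod (u t))\<^sup>2)"
    and eq: "\<And>s. (\<integral>t. cis (s * t) * u t \<partial>lborel) = (\<integral>q. cis (s * ((- \<theta>) \<bullet> q)) * V q \<partial>lborel)"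
    using assms by (auto simp: has_plane_integrals_def)
  have "integrable lborel (\<lambda>t. (cmod (u (- t)))\<^sup>2)"
    using lborel_scaleR(1)[of "\<lambda>t::real. (cmod (u t))\<^sup>2" "-1"] u2 by simp
  moreover have "(\<integral>t. cis (s * t) * u (- t) \<partial>lborel) = (\<integral>q. cis (s * (\<theta> \<bullet> q)) * V q \<partial>lborel)" for s
  proof -
    have "(\<integral>t. cis (s * t) * u (- t) \<partial>lborel) = (\<integral>t. cis (- s * t) * u t \<partial>lborel)"
      by (subst lborel_scaleR(2)[of _ "-1"]) auto
    also have "\<dots> = (\<integral>q. cis (s * (\<theta> \<bullet> q)) * V q \<partial>lborel)"
      unfolding eq by simp
    finally show ?thesis .
  qed
  ultimately show ?thesis
    using supp by (auto simp: has_plane_integrals_def)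
qed

context
  fixes \<theta> :: "'a::euclidean_space"
  assumes unit: "norm \<theta> = 1"
begin

text \<open>
  The point \<open>q\<close> is moved along \<open>\<theta>\<close> into the hyperplane at height \<open>t\<close>. If \<open>q\<close> ranges over the slab
  \<open>0 \<le> \<theta> \<bullet> q \<le> 1\<close> of thickness one, each point of that hyperplane is reached from a segment of
  length one. Integrating over the slab therefore is integrating over the hyperplane, without choosing
  coordinates on it.
\<close>

definition plane_shift :: "real \<times> 'a \<Rightarrow> 'a" where
  "plane_shift = (\<lambda>(t, q). q + (t - \<theta> \<bullet> q) *\<^sub>R \<theta>)"

definition slab :: "'a set" where
  "slab = {q. \<theta> \<bullet> q \<in> {0..1}}"

lemma plane_shift_measurable [measurable]: "plane_shift \<in> lborel \<Otimes>\<^sub>M lborel \<rightarrow>\<^sub>M borel"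
  unfolding plane_shift_def by measurable

lemma slab_measurable [measurable]: "slab \<in> sets borel"
  unfolding slab_def by measurable

lemma inner_plane_shift: "\<theta> \<bullet> plane_shift (t, q) = t"
  using unit by (simp add: plane_shift_def inner_add_right norm_eq_1)

text \<open>
  Exchanging the integrals twice and translating, first \<open>t\<close> by \<open>\<theta> \<bullet> q\<close> and then \<open>q\<close> by
  \<open>t *\<^sub>R \<theta>\<close>, removes the shift from the argument of \<open>F\<close>. What remains is the length of the interval
  of those \<open>t\<close> with \<open>0 \<le> \<theta> \<bullet> q - t \<le> 1\<close>.
\<close>

lemma nn_integral_plane_shift:
  fixes F :: "'a \<Rightarrow> ennreal"
  assumes [measurable]: "F \<in> borel_measurable borel"
  shows "(\<integral>\<^sup>+x. indicator slab (snd x) * F (plane_shift x) \<partial>(lborel \<Otimes>\<^sub>M lborel)) = (\<integral>\<^sup>+q. F q \<partial>lborel)"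
proof -
  let ?I = "indicator {0..1} :: real \<Rightarrow> ennreal"
  have "(\<integral>\<^sup>+x. indicator slab (snd x) * F (plane_shift x) \<partial>(lborel \<Otimes>\<^sub>M lborel))
     = (\<integral>\<^sup>+q. \<integral>\<^sup>+t. ?I (\<theta> \<bullet> q) * F (q + (t - \<theta> \<bullet> q) *\<^sub>R \<theta>) \<partial>lborel \<partial>lborel)"
    by (subst lborel_pair.nn_integral_snd[symmetric])
       (auto simp: slab_def indicator_def plane_shift_def intro!: nn_integral_cong)
  also have "\<dots> = (\<integral>\<^sup>+q. \<integral>\<^sup>+t. ?I (\<theta> \<bullet> q) * F (q + t *\<^sub>R \<theta>) \<partial>lborel \<partial>lborel)"
  proof (rule nn_integral_cong)
    fix q
    show "(\<integral>\<^sup>+t. ?I (\<theta> \<bullet> q) * F (q + (t - \<theta> \<bullet> q) *\<^sub>R \<theta>) \<partial>lborel) = (\<integral>\<^sup>+t. ?I (\<theta> \<bullet> q) * F (q + t *\<^sub>R \<theta>) \<partial>lborel)"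
      by (subst nn_integral_translate[of _ "\<theta> \<bullet> q", symmetric]) auto
  qed
  also have "\<dots> = (\<integral>\<^sup>+t. \<integral>\<^sup>+q. ?I (\<theta> \<bullet> q) * F (q + t *\<^sub>R \<theta>) \<partial>lborel \<partial>lborel)"
    by (rule lborel_pair.Fubini') measurable
  also have "\<dots> = (\<integral>\<^sup>+t. \<integral>\<^sup>+q. ?I (\<theta> \<bullet> q - t) * F q \<partial>lborel \<partial>lborel)"
  proof (rule nn_integral_cong)
    fix t
    show "(\<integral>\<^sup>+q. ?I (\<theta> \<bullet> q) * F (q + t *\<^sub>R \<theta>) \<partial>lborel) = (\<integral>\<^sup>+q. ?I (\<theta> \<bullet> q - t) * F q \<partial>lborel)"
      using unit by (subst nn_integral_translate[of _ "- t *\<^sub>R \<theta>", symmetric]) (auto simp: inner_diff_right norm_eq_1)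
  qed
  also have "\<dots> = (\<integral>\<^sup>+q. \<integral>\<^sup>+t. ?I (\<theta> \<bullet> q - t) * F q \<partial>lborel \<partial>lborel)"
    by (rule lborel_pair.Fubini') measurable
  also have "\<dots> = (\<integral>\<^sup>+q. F q \<partial>lborel)"
  proof (rule nn_integral_cong)
    fix q
    have "(\<integral>\<^sup>+t. ?I (\<theta> \<bullet> q - t) * F q \<partial>lborel) = (\<integral>\<^sup>+t. indicator {\<theta> \<bullet> q - 1..\<theta> \<bullet> q} t * F q \<partial>lborel)"
      by (intro nn_integral_cong) (auto simp: indicator_def)
    also have "\<dots> = F q"
      by (simp add: nn_integral_multc)
    finally show "(\<integral>\<^sup>+t. ?I (\<theta> \<bullet> q - t) * F q \<partial>lborel) = F q" .
  qed
  finally show ?thesis .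
qed

lemma distr_plane_shift:
  "distr (density (lborel \<Otimes>\<^sub>M lborel) (\<lambda>x. indicator slab (snd x))) lborel plane_shift = lborel"
proof (rule measure_eqI)
  fix A :: "'a set" assume "A \<in> sets (distr (density (lborel \<Otimes>\<^sub>M lborel) (\<lambda>x. indicator slab (snd x))) lborel plane_shift)"
  then have A[measurable]: "A \<in> sets borel" by simp
  have "emeasure (distr (density (lborel \<Otimes>\<^sub>M lborel) (\<lambda>x. indicator slab (snd x))) lborel plane_shift) A
      = (\<integral>\<^sup>+q. indicator A q \<partial>distr (density (lborel \<Otimes>\<^sub>M lborel) (\<lambda>x. indicator slab (snd x))) lborel plane_shift)"
    by (rule nn_integral_indicator[symmetric]) simp
  also have "\<dots> = (\<integral>\<^sup>+x. indicator slab (snd x) * indicator A (plane_shift x) \<partial>(lborel \<Otimes>\<^sub>M lborel))"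
    by (subst nn_integral_distr, simp, simp, subst nn_integral_density) auto
  also have "\<dots> = emeasure lborel A"
    by (subst nn_integral_plane_shift) auto
  finally show "emeasure (distr (density (lborel \<Otimes>\<^sub>M lborel) (\<lambda>x. indicator slab (snd x))) lborel plane_shift) A = emeasure lborel A" .
qed simp

lemma integral_plane_shift:
  fixes h :: "'a \<Rightarrow> complex"
  assumes h: "integrable lborel h"
  shows "integrable (lborel \<Otimes>\<^sub>M lborel) (\<lambda>x. indicator slab (snd x) *\<^sub>R h (plane_shift x))"
    and "(\<integral>x. indicator slab (snd x) *\<^sub>R h (plane_shift x) \<partial>(lborel \<Otimes>\<^sub>M lborel)) = (\<integral>q. h q \<partial>lborel)"
proof -
  let ?D = "density (lborel \<Otimes>\<^sub>M lborel) (\<lambda>x. ennreal (indicator slab (snd x)))"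
  have D: "distr ?D lborel plane_shift = lborel"
    using distr_plane_shift by (simp add: ennreal_indicator)
  have [measurable]: "h \<in> borel_measurable borel" using h by auto
  have "integrable (distr ?D lborel plane_shift) h" unfolding D by fact
  then have "integrable ?D (\<lambda>x. h (plane_shift x))"
    by (rule integrable_distr[rotated]) simp
  then show "integrable (lborel \<Otimes>\<^sub>M lborel) (\<lambda>x. indicator slab (snd x) *\<^sub>R h (plane_shift x))"
    by (subst (asm) integrable_density) auto
  have "(\<integral>q. h q \<partial>lborel) = (\<integral>q. h q \<partial>distr ?D lborel plane_shift)" unfolding D ..
  also have "\<dots> = (\<integral>x. h (plane_shift x) \<partial>?D)"
    by (rule integral_distr) auto
  also have "\<dots> = (\<integral>x. indicator slab (snd x) *\<^sub>R h (plane_shift x) \<partial>(lborel \<Otimes>\<^sub>M lborel))"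
    by (rule integral_density) auto
  finally show "(\<integral>x. indicator slab (snd x) *\<^sub>R h (plane_shift x) \<partial>(lborel \<Otimes>\<^sub>M lborel)) = (\<integral>q. h q \<partial>lborel)" ..
qed

text \<open>
  The plane integral \<open>u t\<close> is the integral of \<open>V\<close> over the slab, shifted to height \<open>t\<close>. Only points of
  a fixed ball contribute to it, which bounds its square by the integral of the squared modulus.
\<close>

theorem ex_plane_integrals:
  fixes V :: "'a \<Rightarrow> complex"
  assumes V [measurable]: "V \<in> borel_measurable borel"
    and V1: "integrable lborel V" and V2: "integrable lborel (\<lambda>q. (cmod (V q))\<^sup>2)"
    and supp: "\<And>q. 1 \<le> norm q \<Longrightarrow> V q = 0"
  shows "\<exists>u. has_plane_integrals V \<theta> u"
proof -
  define u where "u t = (\<integral>q. indicator slab q *\<^sub>R V (plane_shift (t, q)) \<partial>lborel)" for t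
  have outside: "V (plane_shift (t, q)) = 0" if "1 \<le> \<bar>t\<bar>" for t q
  proof (rule supp)
    show "1 \<le> norm (plane_shift (t, q))"
      using that Cauchy_Schwarz_ineq2[of \<theta> "plane_shift (t, q)"] unit by (simp add: inner_plane_shift)
  qed
  \<comment> \<open>The shifted point has norm below one, and its height \<open>t\<close> differs from \<open>\<theta> \<bullet> q\<close> by less than two.\<close>
  have near: "norm q < 3" if "V (plane_shift (t, q)) \<noteq> 0" "q \<in> slab" for t q
  proof -
    have "\<bar>t\<bar> < 1" using that outside[of t q] by force
    moreover have "norm (plane_shift (t, q)) < 1" using that supp[of "plane_shift (t, q)"] by force
    moreover have "\<bar>\<theta> \<bullet> q\<bar> \<le> 1" using that by (auto simp: slab_def)
    moreover have "q = plane_shift (t, q) - (t - \<theta> \<bullet> q) *\<^sub>R \<theta>" by (simp add: plane_shift_def)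
    then have "norm q \<le> norm (plane_shift (t, q)) + \<bar>t - \<theta> \<bullet> q\<bar>"
      using unit by (metis norm_scaleR mult.right_neutral norm_triangle_ineq4 real_norm_def)
    ultimately show ?thesis by linarith
  qed
  have u_meas: "u \<in> borel_measurable borel"
  proof -
    have "(\<lambda>t. \<integral>q. indicator slab q *\<^sub>R V (plane_shift (t, q)) \<partial>lborel) \<in> borel_measurable lborel"
      by (intro lborel.borel_measurable_lebesgue_integral) measurable
    then show ?thesis by (simp add: u_def[abs_def])
  qed
  have u_supp: "u t = 0" if "t \<notin> {-1..1}" for t
    using that by (auto simp: u_def outside)
  define v3 where "v3 = emeasure lborel (ball (0::'a) 3)"
  have v3: "v3 < \<infinity>" unfolding v3_def by (rule emeasure_lborel_ball_finite)
  \<comment> \<open>Cauchy-Schwarz on the ball of radius three. A divergent integral has the value \<open>0\<close>, so the bound is true then too.\<close>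
  have u_le: "ennreal ((cmod (u t))\<^sup>2) \<le> v3 * (\<integral>\<^sup>+q. indicator slab q * ennreal ((cmod (V (plane_shift (t, q))))\<^sup>2) \<partial>lborel)" for t
  proof -
    let ?k = "\<lambda>q. indicator slab q *\<^sub>R V (plane_shift (t, q))"
    have [measurable]: "(\<lambda>q. plane_shift (t, q)) \<in> borel \<rightarrow>\<^sub>M borel" "ball (0::'a) 3 \<in> sets borel"
      by (simp_all add: plane_shift_def)
    have "ennreal (cmod (u t)) \<le> (\<integral>\<^sup>+q. ennreal (cmod (?k q)) \<partial>lborel)"
    proof (cases "integrable lborel ?k")
      case True
      then show ?thesis unfolding u_def by (rule integral_norm_bound_ennreal)
    next
      case False
      then show ?thesis by (simp add: u_def not_integrable_integral_eq)
    qed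
    also have "\<dots> = (\<integral>\<^sup>+q. indicator (ball 0 3) q * ennreal (cmod (?k q)) \<partial>lborel)"
      using near[of t] by (intro nn_integral_cong) (auto simp: indicator_def)
    finally have "(ennreal (cmod (u t)))\<^sup>2 \<le> (\<integral>\<^sup>+q. indicator (ball 0 3) q * ennreal (cmod (?k q)) \<partial>lborel)\<^sup>2"
      by (rule power_mono) simp
    also have "\<dots> \<le> (\<integral>\<^sup>+q. (indicator (ball (0::'a) 3) q)\<^sup>2 \<partial>lborel) * (\<integral>\<^sup>+q. (ennreal (cmod (?k q)))\<^sup>2 \<partial>lborel)"
      by (rule Cauchy_Schwarz_nn_integral) measurable
    also have "(\<integral>\<^sup>+q. (indicator (ball (0::'a) 3) q)\<^sup>2 \<partial>lborel) = v3"
    proof -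
      have "(\<integral>\<^sup>+q. (indicator (ball (0::'a) 3) q)\<^sup>2 \<partial>lborel) = (\<integral>\<^sup>+q. indicator (ball (0::'a) 3) q \<partial>lborel)"
        by (intro nn_integral_cong) (auto simp: indicator_def)
      also have "\<dots> = v3"
        unfolding v3_def by (rule nn_integral_indicator) auto
      finally show ?thesis .
    qed
    also have "(\<integral>\<^sup>+q. (ennreal (cmod (?k q)))\<^sup>2 \<partial>lborel)
        = (\<integral>\<^sup>+q. indicator slab q * ennreal ((cmod (V (plane_shift (t, q))))\<^sup>2) \<partial>lborel)"
      by (intro nn_integral_cong) (auto simp: indicator_def ennreal_power)
    finally show ?thesis by (simp add: ennreal_power)
  qed
  have u2: "integrable lborel (\<lambda>t. (cmod (u t))\<^sup>2)"
  proof (rule integrableI_bounded)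
    have "(\<integral>\<^sup>+t. ennreal ((cmod (u t))\<^sup>2) \<partial>lborel)
        \<le> (\<integral>\<^sup>+t. v3 * (\<integral>\<^sup>+q. indicator slab q * ennreal ((cmod (V (plane_shift (t, q))))\<^sup>2) \<partial>lborel) \<partial>lborel)"
      by (intro nn_integral_mono u_le)
    also have "\<dots> = v3 * (\<integral>\<^sup>+t. (\<integral>\<^sup>+q. indicator slab q * ennreal ((cmod (V (plane_shift (t, q))))\<^sup>2) \<partial>lborel) \<partial>lborel)"
      by (rule nn_integral_cmult) measurable
    also have "(\<integral>\<^sup>+t. (\<integral>\<^sup>+q. indicator slab q * ennreal ((cmod (V (plane_shift (t, q))))\<^sup>2) \<partial>lborel) \<partial>lborel)
        = (\<integral>\<^sup>+x. indicator slab (snd x) * ennreal ((cmod (V (plane_shift x)))\<^sup>2) \<partial>(lborel \<Otimes>\<^sub>M lborel))"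
      by (subst lborel.nn_integral_fst[symmetric]) auto
    also have "\<dots> = (\<integral>\<^sup>+q. ennreal ((cmod (V q))\<^sup>2) \<partial>lborel)"
      by (rule nn_integral_plane_shift) measurable
    also have "v3 * \<dots> < \<infinity>"
      using v3 V2 by (simp add: integrable_iff_bounded ennreal_mult_less_top)
    finally show "(\<integral>\<^sup>+t. ennreal (norm ((cmod (u t))\<^sup>2)) \<partial>lborel) < \<infinity>" by simp
  qed (use u_meas in auto)
  have u_fourier: "(\<integral>t. cis (s * t) * u t \<partial>lborel) = (\<integral>q. cis (s * (\<theta> \<bullet> q)) * V q \<partial>lborel)" for s
  proof -
    let ?h = "\<lambda>q. cis (s * (\<theta> \<bullet> q)) * V q"
    have h: "integrable lborel ?h"
      by (rule Bochner_Integration.integrable_bound[OF V1]) (auto simp: norm_mult)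
    have "(\<integral>q. ?h q \<partial>lborel) = (\<integral>x. indicator slab (snd x) *\<^sub>R ?h (plane_shift x) \<partial>(lborel \<Otimes>\<^sub>M lborel))"
      by (rule integral_plane_shift(2)[OF h, symmetric])
    also have "\<dots> = (\<integral>t. \<integral>q. indicator slab q *\<^sub>R ?h (plane_shift (t, q)) \<partial>lborel \<partial>lborel)"
      using lborel_pair.integral_fst'[OF integral_plane_shift(1)[OF h]] by simp
    also have "\<dots> = (\<integral>t. cis (s * t) * u t \<partial>lborel)"
      unfolding u_def inner_plane_shift
      by (intro Bochner_Integration.integral_cong refl) (simp flip: integral_mult_right_zero)
    finally show ?thesis ..
  qed
  show ?thesis
    unfolding has_plane_integrals_def using u_meas u_supp u2 u_fourier by blast
qed

end

section \<open>Inverting the prolate operator\<close>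

lemma finite_measure_leb_I: "finite_measure leb_I"
  by (intro finite_measure_lebesgue_on) auto

lemma measurable_ident_leb_I [measurable]: "(\<lambda>x. x) \<in> leb_I \<rightarrow>\<^sub>M borel"
  using id_borel_measurable_lebesgue_on[of "{-1..1::real}"] by (simp add: id_def)

lemma L2_leb_I_integrable:
  assumes "f \<in> L2 leb_I"
  shows "integrable leb_I f"
proof (rule Bochner_Integration.integrable_bound)
  interpret finite_measure leb_I by (rule finite_measure_leb_I)
  show "integrable leb_I (\<lambda>x. 1 + (cmod (f x))\<^sup>2)"
    using assms by (auto simp: L2_def)
  show "AE x in leb_I. norm (f x) \<le> norm (1 + (cmod (f x))\<^sup>2)"
    using cmod_le_1_plus_square[of "f _"] by (auto intro: order_trans[OF _ abs_ge_self])
qed (use assms in \<open>auto simp: L2_def\<close>)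

lemma prolate_op_cis: "prolate_op c f x = (LINT y|leb_I. cis (c * x * y) * f y)"
  by (simp add: prolate_op_def cis_conv_exp)

lemma prolate_op_measurable:
  assumes [measurable]: "f \<in> borel_measurable leb_I"
  shows "prolate_op c f \<in> borel_measurable leb_I"
proof -
  interpret finite_measure leb_I by (rule finite_measure_leb_I)
  show ?thesis
    unfolding prolate_op_cis[abs_def] by (intro borel_measurable_lebesgue_integral) measurable
qed

lemma prolate_op_symmetric:
  assumes f: "f \<in> L2 leb_I" and g: "g \<in> L2 leb_I"
  shows "(LINT x|leb_I. f x * prolate_op c g x) = (LINT y|leb_I. prolate_op c f y * g y)"
proof -
  interpret finite_measure leb_I by (rule finite_measure_leb_I)
  interpret pair_sigma_finite leb_I leb_I ..
  have [measurable]: "f \<in> borel_measurable leb_I" "g \<in> borel_measurable leb_I"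
    using f g by (auto simp: L2_def)
  have f1: "integrable leb_I f" and g1: "integrable leb_I g"
    using f g by (auto intro: L2_leb_I_integrable)
  let ?k = "\<lambda>x y. f x * (cis (c * x * y) * g y)"
  have int: "integrable (leb_I \<Otimes>\<^sub>M leb_I) (\<lambda>(x, y). ?k x y)"
  proof (rule Fubini_integrable)
    show "integrable leb_I (\<lambda>x. LINT y|leb_I. norm (case (x, y) of (x, y) \<Rightarrow> ?k x y))"
      using f1 g1 by (simp add: norm_mult)
    have "integrable leb_I (\<lambda>y. cis (c * x * y) * g y)" for x
      by (rule Bochner_Integration.integrable_bound[OF g1]) (auto simp: norm_mult)
    then show "AE x in leb_I. integrable leb_I (\<lambda>y. case (x, y) of (x, y) \<Rightarrow> ?k x y)"
      by simp
  qed measurable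
  have "(LINT x|leb_I. f x * prolate_op c g x) = (LINT x|leb_I. LINT y|leb_I. ?k x y)"
    by (simp add: prolate_op_cis)
  also have "\<dots> = (LINT y|leb_I. LINT x|leb_I. ?k x y)"
    by (rule Fubini_integral[OF int, symmetric])
  also have "\<dots> = (LINT y|leb_I. prolate_op c f y * g y)"
  proof (rule Bochner_Integration.integral_cong[OF refl])
    fix y
    have "(LINT x|leb_I. ?k x y) = (LINT x|leb_I. cis (c * y * x) * f x * g y)"
      by (intro Bochner_Integration.integral_cong refl) (simp add: mult_ac)
    then show "(LINT x|leb_I. ?k x y) = prolate_op c f y * g y"
      by (simp add: prolate_op_cis)
  qed
  finally show ?thesis .
qed

text \<open>
  Moving the operator over to the eigenfunction shows that the coefficient of \<open>g\<close> is \<open>\<mu> j\<close> times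
  that of \<open>u\<close>, and the factor \<open>1 / \<mu> j\<close> of the inverse removes it. What is left is the expansion of
  \<open>u\<close>, which converges because the wave functions are complete. The values of \<open>g\<close> at the end points
  are left open, since the data are given on the open ball.
\<close>

lemma prolate_inv_partial_tendsto:
  assumes sys: "prolate_system c \<psi> \<mu>" and u: "u \<in> L2 leb_I"
    and g: "\<And>x. x \<in> {-1<..<1} \<Longrightarrow> g x = prolate_op c u x"
  shows "L2_tendsto leb_I (prolate_inv_partial \<psi> \<mu> g) u sequentially"
proof -
  interpret finite_measure leb_I by (rule finite_measure_leb_I)
  have u_meas [measurable]: "u \<in> borel_measurable leb_I" using u by (simp add: L2_def)
  have psi: "(\<lambda>x. complex_of_real (\<psi> j x)) \<in> L2 leb_I" for j
    using sys by (simp add: prolate_system_def)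
  then have psi_meas [measurable]: "(\<lambda>x. complex_of_real (\<psi> j x)) \<in> borel_measurable leb_I" for j
    by (simp add: L2_def)
  have eigen: "AE x in leb_I. prolate_op c (\<lambda>y. complex_of_real (\<psi> j y)) x = \<mu> j * complex_of_real (\<psi> j x)" for j
    using sys by (simp add: prolate_system_def)
  have mono: "0 < cmod (\<mu> (Suc j)) \<and> cmod (\<mu> (Suc j)) < cmod (\<mu> j)" for j
    using sys by (simp add: prolate_system_def)
  have nz: "\<mu> j \<noteq> 0" for j
    using mono[of j] by auto
  note [measurable] = prolate_op_measurable
  have coeff: "(LINT x|leb_I. complex_of_real (\<psi> j x) * g x) = \<mu> j * (LINT x|leb_I. complex_of_real (\<psi> j x) * u x)" for j
  proof -
    \<comment> \<open>Changing a measurable function at two points keeps it measurable.\<close>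
    have "(\<lambda>x. complex_of_real (\<psi> j x) * g x) \<in> borel_measurable leb_I
        \<longleftrightarrow> (\<lambda>x. complex_of_real (\<psi> j x) * (if x = 1 then g 1 else if x = -1 then g (-1) else prolate_op c u x)) \<in> borel_measurable leb_I"
      by (intro measurable_cong) (use g in auto)
    then have g_meas: "(\<lambda>x. complex_of_real (\<psi> j x) * g x) \<in> borel_measurable leb_I"
      by simp
    have "AE x in leb_I. x \<noteq> 1 \<and> x \<noteq> -1"
    proof -
      have "AE x in lborel. x \<noteq> (1::real)" "AE x in lborel. x \<noteq> (-1::real)"
        by (rule AE_lborel_singleton)+
      then have "AE x in lebesgue. x \<noteq> (1::real) \<and> x \<noteq> -1"
        unfolding AE_completion_iff by eventually_elim auto
      then show ?thesis
        by (subst AE_restrict_space_iff) auto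
    qed
    moreover have "AE x in leb_I. x \<in> {-1..1}" by (rule AE_I2) simp
    ultimately have "AE x in leb_I. complex_of_real (\<psi> j x) * g x = complex_of_real (\<psi> j x) * prolate_op c u x"
      by eventually_elim (use g in auto)
    then have "(LINT x|leb_I. complex_of_real (\<psi> j x) * g x) = (LINT x|leb_I. complex_of_real (\<psi> j x) * prolate_op c u x)"
      by (intro integral_cong_AE g_meas) auto
    also have "\<dots> = (LINT x|leb_I. prolate_op c (\<lambda>y. complex_of_real (\<psi> j y)) x * u x)"
      by (rule prolate_op_symmetric[OF psi u])
    also have "\<dots> = (LINT x|leb_I. \<mu> j * (complex_of_real (\<psi> j x) * u x))"
    proof (rule integral_cong_AE)
      show "AE x in leb_I. prolate_op c (\<lambda>y. complex_of_real (\<psi> j y)) x * u x = \<mu> j * (complex_of_real (\<psi> j x) * u x)"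
        using eigen[of j] by eventually_elim simp
    qed measurable
    finally show ?thesis by simp
  qed
  have "prolate_inv_partial \<psi> \<mu> g = (\<lambda>n y. \<Sum>j<n. complex_of_real (\<psi> j y) * (LINT x|leb_I. complex_of_real (\<psi> j x) * u x))"
    unfolding prolate_inv_partial_def[abs_def] coeff using nz by (simp add: fun_eq_iff)
  then show ?thesis
    using sys u by (simp add: prolate_system_def)
qed

lemma integral_leb_I:
  fixes f :: "real \<Rightarrow> 'b::{banach, second_countable_topology}"
  assumes [measurable]: "f \<in> borel_measurable borel" and supp: "\<And>t. t \<notin> {-1..1} \<Longrightarrow> f t = 0"
  shows "integrable leb_I f \<longleftrightarrow> integrable lborel f" and "(LINT t|leb_I. f t) = (\<integral>t. f t \<partial>lborel)"
proof -
  have I: "{-1..1::real} \<inter> space lebesgue \<in> sets lebesgue" by auto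
  have eq: "(\<lambda>t. indicator {-1..1} t *\<^sub>R f t) = f"
    using supp by (auto simp: indicator_def fun_eq_iff)
  show "integrable leb_I f \<longleftrightarrow> integrable lborel f"
    by (simp only: integrable_restrict_space[OF I] eq) (rule integrable_completion, simp)
  show "(LINT t|leb_I. f t) = (\<integral>t. f t \<partial>lborel)"
    by (simp only: integral_restrict_space[OF I] eq) (rule integral_completion, simp)
qed

lemma has_plane_integrals_L2:
  assumes "has_plane_integrals V \<theta> u"
  shows "u \<in> L2 leb_I"
proof -
  have [measurable]: "u \<in> borel_measurable borel"
    and supp: "\<And>t. t \<notin> {-1..1} \<Longrightarrow> u t = 0"
    and u2: "integrable lborel (\<lambda>t. (cmod (u t))\<^sup>2)"
    using assms by (auto simp: has_plane_integrals_def)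
  have "integrable leb_I (\<lambda>t. (cmod (u t))\<^sup>2)"
    by (subst integral_leb_I(1)) (use supp u2 in auto)
  moreover have "u \<in> borel_measurable leb_I"
    by measurable
  ultimately show ?thesis by (simp add: L2_def)
qed

lemma prolate_op_plane_integrals:
  assumes "has_plane_integrals V \<theta> u"
  shows "prolate_op c u x = (\<integral>q. cis (c * x * (\<theta> \<bullet> q)) * V q \<partial>lborel)"
proof -
  have [measurable]: "u \<in> borel_measurable borel"
    and supp: "\<And>t. t \<notin> {-1..1} \<Longrightarrow> u t = 0"
    and eq: "\<And>s. (\<integral>t. cis (s * t) * u t \<partial>lborel) = (\<integral>q. cis (s * (\<theta> \<bullet> q)) * V q \<partial>lborel)"
    using assms by (auto simp: has_plane_integrals_def)
  have "prolate_op c u x = (\<integral>t. cis (c * x * t) * u t \<partial>lborel)"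
    unfolding prolate_op_cis by (rule integral_leb_I(2)) (use supp in auto)
  then show ?thesis by (simp only: eq)
qed

section \<open>Reconstruction from band-limited data\<close>

text \<open>
  The complement of the essential support is a union of open sets on each of which \<open>v\<close> vanishes
  almost everywhere; by the Lindelof property countably many of them cover it.
\<close>

lemma AE_eq_0_outside_ess_support:
  fixes v :: "'a::euclidean_space \<Rightarrow> complex"
  shows "AE q in lborel. q \<notin> ess_support v \<longrightarrow> v q = 0"
proof -
  let ?\<U> = "{U. open U \<and> (AE y in lebesgue. y \<in> U \<longrightarrow> v y = 0)}"
  obtain \<V> where \<V>: "\<V> \<subseteq> ?\<U>" "countable \<V>" "\<Union>\<V> = \<Union>?\<U>"
    using Lindelof[of ?\<U>] by auto
  have "AE y in lebesgue. \<forall>U\<in>\<V>. y \<in> U \<longrightarrow> v y = 0"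
    using \<V> by (subst AE_ball_countable) auto
  then have "AE y in lborel. \<forall>U\<in>\<V>. y \<in> U \<longrightarrow> v y = 0"
    by (simp only: AE_completion_iff)
  moreover have "- ess_support v = \<Union>\<V>"
    unfolding \<V>(3) ess_support_def by auto
  ultimately show ?thesis by fastforce
qed

lemma lebesgue_measurable_borel_version:
  fixes v :: "'a::euclidean_space \<Rightarrow> complex"
  assumes [measurable]: "v \<in> borel_measurable lebesgue"
  obtains v' where "v' \<in> borel_measurable borel" "AE q in lborel. v q = v' q"
proof -
  have "(\<lambda>q. Re (v q)) \<in> borel_measurable lebesgue" "(\<lambda>q. Im (v q)) \<in> borel_measurable lebesgue"
    by measurable
  then obtain a b where [measurable]: "a \<in> borel_measurable lborel" "b \<in> borel_measurable lborel"
    and ab: "AE q in lborel. Re (v q) = a q" "AE q in lborel. Im (v q) = b q"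
    using completion_ex_borel_measurable_real[of "\<lambda>q. Re (v q)" lborel]
      completion_ex_borel_measurable_real[of "\<lambda>q. Im (v q)" lborel] by blast
  show thesis
  proof (rule that)
    show "(\<lambda>q. complex_of_real (a q) + \<i> * complex_of_real (b q)) \<in> borel_measurable borel"
      by measurable
    show "AE q in lborel. v q = complex_of_real (a q) + \<i> * complex_of_real (b q)"
      using ab by eventually_elim (simp add: complex_eq_iff)
  qed
qed

text \<open>
  Working with a Borel measurable version of the dilated function that vanishes identically outside
  the unit ball makes the product measures used for exchanging integrals available.
\<close>

lemma rescaled_version:
  fixes v :: "'a::euclidean_space \<Rightarrow> complex"
  assumes "0 < \<sigma>" and v: "v \<in> L2 lebesgue" and supp: "ess_support v \<subseteq> ball 0 \<sigma>"
  obtains V where "V \<in> borel_measurable borel" "integrable lborel V" "integrable lborel (\<lambda>q. (cmod (V q))\<^sup>2)"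
    "\<And>q. 1 \<le> norm q \<Longrightarrow> V q = 0" "AE q in lborel. v q = V (q /\<^sub>R \<sigma>)"
proof -
  have v_meas: "v \<in> borel_measurable lebesgue" and v2: "integrable lebesgue (\<lambda>q. (cmod (v q))\<^sup>2)"
    using v by (auto simp: L2_def)
  obtain v' where v'[measurable]: "v' \<in> borel_measurable borel" and vv': "AE q in lborel. v q = v' q"
    using lebesgue_measurable_borel_version[OF v_meas] .
  have [measurable]: "ball (0::'a) 1 \<in> sets borel" by auto
  define V where "V q = indicator (ball 0 1) q *\<^sub>R v' (\<sigma> *\<^sub>R q)" for q
  have V [measurable]: "V \<in> borel_measurable borel"
    unfolding V_def[abs_def] by measurable
  have ae: "AE q in lborel. v q = V (q /\<^sub>R \<sigma>)"
    using vv' AE_eq_0_outside_ess_support[of v]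
  proof eventually_elim
    fix q assume "v q = v' q" "q \<notin> ess_support v \<longrightarrow> v q = 0"
    then show "v q = V (q /\<^sub>R \<sigma>)"
      using supp \<open>0 < \<sigma>\<close> by (auto simp: V_def indicator_def field_simps subset_iff)
  qed
  have "integrable lebesgue (\<lambda>q. (cmod (V (q /\<^sub>R \<sigma>)))\<^sup>2)"
  proof (subst integrable_cong_AE)
    show "AE q in lebesgue. (cmod (V (q /\<^sub>R \<sigma>)))\<^sup>2 = (cmod (v q))\<^sup>2"
      unfolding AE_completion_iff using ae by eventually_elim simp
    show "(\<lambda>q. (cmod (V (q /\<^sub>R \<sigma>)))\<^sup>2) \<in> borel_measurable lebesgue"
      by (rule measurable_completion) simp
  qed (use v_meas v2 in auto)
  then have "integrable lborel (\<lambda>q. (cmod (V (inverse \<sigma> *\<^sub>R q)))\<^sup>2)"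
    by (subst (asm) integrable_completion) auto
  then have V2: "integrable lborel (\<lambda>q. (cmod (V q))\<^sup>2)"
    using \<open>0 < \<sigma>\<close> by (subst (asm) lborel_scaleR(1)[of "\<lambda>q. (cmod (V q))\<^sup>2"]) auto
  have V0: "V q = 0" if "1 \<le> norm q" for q
    using that by (simp add: V_def)
  have V1: "integrable lborel V"
  proof (rule Bochner_Integration.integrable_bound)
    show "integrable lborel (\<lambda>q. indicator (ball (0::'a) 1) q + (cmod (V q))\<^sup>2)"
      using V2 emeasure_lborel_ball_finite[of "0::'a" 1] by (intro Bochner_Integration.integrable_add integrable_real_indicator) auto
    show "AE q in lborel. norm (V q) \<le> norm (indicator (ball (0::'a) 1) q + (cmod (V q))\<^sup>2)"
    proof (rule AE_I2)
      fix q
      have "cmod (V q) \<le> 1 + (cmod (V q))\<^sup>2" by (rule cmod_le_1_plus_square)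
      then show "norm (V q) \<le> norm (indicator (ball (0::'a) 1) q + (cmod (V q))\<^sup>2)"
        using V0[of q] by (auto simp: indicator_def)
    qed
  qed simp
  show thesis by (rule that[OF V V1 V2 V0 ae])
qed

lemma fourier_rescaled:
  fixes v V :: "'a::euclidean_space \<Rightarrow> complex"
  assumes "0 < \<sigma>" and v: "v \<in> borel_measurable lebesgue" and V[measurable]: "V \<in> borel_measurable borel"
    and ae: "AE q in lborel. v q = V (q /\<^sub>R \<sigma>)"
  shows "fourier v p = complex_of_real ((\<sigma> / (2 * pi)) ^ DIM('a)) * (\<integral>q. cis (\<sigma> * (p \<bullet> q)) * V q \<partial>lborel)"
proof -
  have cis_leb: "(\<lambda>q. cis (p \<bullet> q)) \<in> borel_measurable lebesgue"
    by (rule measurable_completion) simp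
  have "(LINT q|lebesgue. exp (\<i> * complex_of_real (p \<bullet> q)) * v q) = (LINT q|lebesgue. cis (p \<bullet> q) * V (inverse \<sigma> *\<^sub>R q))"
    unfolding cis_conv_exp[symmetric]
  proof (rule integral_cong_AE)
    show "AE q in lebesgue. cis (p \<bullet> q) * v q = cis (p \<bullet> q) * V (q /\<^sub>R \<sigma>)"
      unfolding AE_completion_iff using ae by eventually_elim simp
    show "(\<lambda>q. cis (p \<bullet> q) * V (q /\<^sub>R \<sigma>)) \<in> borel_measurable lebesgue"
      by (rule measurable_completion) simp
  qed (intro borel_measurable_times cis_leb v)
  also have "\<dots> = (\<integral>q. cis (p \<bullet> q) * V (inverse \<sigma> *\<^sub>R q) \<partial>lborel)"
    by (rule integral_completion) simp
  also have "\<dots> = \<bar>\<sigma>\<bar> ^ DIM('a) *\<^sub>R (\<integral>q. cis (p \<bullet> (\<sigma> *\<^sub>R q)) * V (inverse \<sigma> *\<^sub>R (\<sigma> *\<^sub>R q)) \<partial>lborel)"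
    by (rule lborel_scaleR(2)) (use \<open>0 < \<sigma>\<close> in auto)
  also have "\<dots> = \<sigma> ^ DIM('a) *\<^sub>R (\<integral>q. cis (\<sigma> * (p \<bullet> q)) * V q \<partial>lborel)"
    using \<open>0 < \<sigma>\<close> by simp
  finally show ?thesis
    unfolding fourier_def by (simp add: power_divide scaleR_conv_of_real)
qed

lemma slice_data_eq_prolate_op:
  fixes v w V :: "'a::euclidean_space \<Rightarrow> complex"
  assumes "0 < r" "0 < \<sigma>" and v: "v \<in> borel_measurable lebesgue" and V: "V \<in> borel_measurable borel"
    and ae: "AE q in lborel. v q = V (q /\<^sub>R \<sigma>)" and w: "\<forall>p \<in> ball 0 r. w p = fourier v p"
    and "norm \<theta> = 1" and u: "has_plane_integrals V \<theta> u" and x: "x \<in> {-1<..<1}"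
  shows "slice_data r \<sigma> w \<theta> x = prolate_op (r * \<sigma>) u x"
proof -
  have "(r * x) *\<^sub>R \<theta> \<in> ball 0 r"
    using \<open>norm \<theta> = 1\<close> \<open>0 < r\<close> x by (auto simp: abs_mult)
  then have "slice_data r \<sigma> w \<theta> x = complex_of_real ((2 * pi / \<sigma>) ^ DIM('a)) *
      (complex_of_real ((\<sigma> / (2 * pi)) ^ DIM('a)) * (\<integral>q. cis (\<sigma> * (((r * x) *\<^sub>R \<theta>) \<bullet> q)) * V q \<partial>lborel))"
    unfolding slice_data_def using w fourier_rescaled[OF \<open>0 < \<sigma>\<close> v V ae] by simp
  also have "\<dots> = complex_of_real ((2 * pi / \<sigma>) ^ DIM('a) * (\<sigma> / (2 * pi)) ^ DIM('a)) * (\<integral>q. cis (\<sigma> * (((r * x) *\<^sub>R \<theta>) \<bullet> q)) * V q \<partial>lborel)"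
    by (simp only: of_real_mult mult.assoc)
  also have "(2 * pi / \<sigma>) ^ DIM('a) * (\<sigma> / (2 * pi)) ^ DIM('a) = 1"
    using \<open>0 < \<sigma>\<close> by (simp flip: power_mult_distrib)
  also have "(\<lambda>q. \<sigma> * (((r * x) *\<^sub>R \<theta>) \<bullet> q)) = (\<lambda>q. r * \<sigma> * x * (\<theta> \<bullet> q))"
    by (simp add: fun_eq_iff)
  finally show ?thesis
    by (simp only: prolate_op_plane_integrals[OF u] of_real_1 mult_1)
qed

theorem theorem1p1:
  fixes v w :: "'a::euclidean_space \<Rightarrow> complex"
    and r \<sigma> c :: real
    and \<psi> :: "nat \<Rightarrow> real \<Rightarrow> real"
    and \<mu> :: "nat \<Rightarrow> complex"
  assumes "r > 0" and "\<sigma> > 0" and "c = r * \<sigma>"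
    and "prolate_system c \<psi> \<mu>"
    and "v \<in> L2 lebesgue"
    and "ess_support v \<subseteq> ball 0 \<sigma>"
    and "\<forall>p \<in> ball 0 r. w p = fourier v p"
  shows "(\<forall>\<theta> \<in> sphere 0 1.
            L2_tendsto leb_I (prolate_inv_partial \<psi> \<mu> (slice_data r \<sigma> w \<theta>))
              (prolate_inv \<psi> \<mu> (slice_data r \<sigma> w \<theta>)) sequentially)
       \<and> (\<forall>\<theta> \<in> sphere 0 1. AE t in lebesgue.
            radon_data \<psi> \<mu> r \<sigma> w t \<theta> = radon_data \<psi> \<mu> r \<sigma> w (- t) (- \<theta>))
       \<and> L2_tendsto lebesgue (inv_radon_trunc (radon_data \<psi> \<mu> r \<sigma> w))
            (inv_radon (radon_data \<psi> \<mu> r \<sigma> w)) at_top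
       \<and> (AE q in lebesgue. v q = inv_radon (radon_data \<psi> \<mu> r \<sigma> w) (q /\<^sub>R \<sigma>))"
proof -
  obtain V where V [measurable]: "V \<in> borel_measurable borel" and V1: "integrable lborel V"
    and V2: "integrable lborel (\<lambda>q. (cmod (V q))\<^sup>2)" and V0: "\<And>q. 1 \<le> norm q \<Longrightarrow> V q = 0"
    and vV: "AE q in lborel. v q = V (q /\<^sub>R \<sigma>)"
    using rescaled_version[OF assms(2,5,6)] by blast
  have v_meas: "v \<in> borel_measurable lebesgue" using assms(5) by (simp add: L2_def)
  let ?g = "slice_data r \<sigma> w"
  let ?f = "radon_data \<psi> \<mu> r \<sigma> w"
  have tendsto: "L2_tendsto leb_I (prolate_inv_partial \<psi> \<mu> (?g \<theta>)) u sequentially"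
    if "norm \<theta> = 1" "has_plane_integrals V \<theta> u" for \<theta> u
    using slice_data_eq_prolate_op[OF assms(1,2) v_meas V vV assms(7) that] \<open>c = r * \<sigma>\<close>
    by (intro prolate_inv_partial_tendsto[OF assms(4) has_plane_integrals_L2[OF that(2)]]) simp
  have ex: "\<exists>u. has_plane_integrals V \<theta> u" if "norm \<theta> = 1" for \<theta>
    by (rule ex_plane_integrals[OF that V V1 V2 V0])
  have prolate: "L2_tendsto leb_I (prolate_inv_partial \<psi> \<mu> (?g \<theta>)) (prolate_inv \<psi> \<mu> (?g \<theta>)) sequentially"
    if "norm \<theta> = 1" for \<theta>
    unfolding prolate_inv_def using ex[OF that] tendsto[OF that] L2_lim_eq(1) sequentially_bot by metis
  have f_eq: "AE t in lebesgue. ?f t \<theta> = u t" if \<theta>: "norm \<theta> = 1" and u: "has_plane_integrals V \<theta> u" for \<theta> u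
  proof -
    have "AE t in leb_I. prolate_inv \<psi> \<mu> (?g \<theta>) t = u t"
      unfolding prolate_inv_def by (rule L2_lim_eq(2)[OF tendsto[OF \<theta> u] sequentially_bot])
    then have "AE t in lebesgue. t \<in> {-1..1} \<longrightarrow> prolate_inv \<psi> \<mu> (?g \<theta>) t = u t"
      by (subst (asm) AE_restrict_space_iff) auto
    then show ?thesis
      by eventually_elim (use u in \<open>auto simp: radon_data_def has_plane_integrals_def\<close>)
  qed
  have f_meas: "(\<lambda>t. ?f t \<theta>) \<in> borel_measurable lebesgue" if "norm \<theta> = 1" for \<theta>
  proof -
    have "prolate_inv \<psi> \<mu> (?g \<theta>) \<in> borel_measurable leb_I"
      using prolate[OF that] by (simp add: L2_tendsto_def L2_def)
    then show ?thesis
      unfolding radon_data_def by (subst borel_measurable_if) auto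
  qed
  \<comment> \<open>The reflected plane integrals for \<open>- \<theta>\<close> and those for \<open>\<theta>\<close> are limits of the same partial sums.\<close>
  have symmetric: "AE t in lebesgue. ?f t \<theta> = ?f (- t) (- \<theta>)" if \<theta>: "norm \<theta> = 1" for \<theta>
  proof -
    obtain u where u: "has_plane_integrals V (- \<theta>) u" using ex[of "- \<theta>"] \<theta> by auto
    have "AE t in lborel. ?f t (- \<theta>) = u t"
      using f_eq[OF _ u] \<theta> by (simp add: AE_completion_iff)
    then have "AE t in lborel. ?f (- t) (- \<theta>) = u (- t)"
      using AE_lborel_scaleR[of "\<lambda>t. ?f t (- \<theta>) = u t" "-1"] by simp
    moreover have "AE t in lborel. ?f t \<theta> = u (- t)"
      using f_eq[OF \<theta> has_plane_integrals_uminus[OF u]] by (simp add: AE_completion_iff)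
    ultimately have "AE t in lborel. ?f t \<theta> = ?f (- t) (- \<theta>)"
      by eventually_elim simp
    then show ?thesis by (simp only: AE_completion_iff)
  qed
  \<comment> \<open>Here the data are extrapolated: \<open>s\<close> is arbitrary, while only the values with \<open>\<bar>s\<bar> < c\<close> were given.\<close>
  have radon_fourier: "radon_fourier ?f s \<theta> = complex_of_real (1 / (2 * pi)) * (\<integral>q. cis ((s *\<^sub>R \<theta>) \<bullet> q) * V q \<partial>lborel)"
    if \<theta>: "norm \<theta> = 1" for s \<theta>
  proof -
    obtain u where u: "has_plane_integrals V \<theta> u" using ex[OF \<theta>] by auto
    then have [measurable]: "u \<in> borel_measurable borel"
      and eq: "(\<integral>t. cis (s * t) * u t \<partial>lborel) = (\<integral>q. cis (s * (\<theta> \<bullet> q)) * V q \<partial>lborel)"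
      by (auto simp: has_plane_integrals_def)
    have cis_leb: "(\<lambda>t. cis (s * t)) \<in> borel_measurable lebesgue"
      by (rule measurable_completion) simp
    have "(LINT t|lebesgue. exp (\<i> * complex_of_real (s * t)) * ?f t \<theta>) = (LINT t|lebesgue. cis (s * t) * u t)"
      unfolding cis_conv_exp[symmetric]
    proof (rule integral_cong_AE)
      show "AE t in lebesgue. cis (s * t) * ?f t \<theta> = cis (s * t) * u t"
        using f_eq[OF \<theta> u] by eventually_elim simp
      show "(\<lambda>t. cis (s * t) * u t) \<in> borel_measurable lebesgue"
        by (rule measurable_completion) simp
    qed (intro borel_measurable_times cis_leb f_meas \<theta>)
    also have "\<dots> = (\<integral>t. cis (s * t) * u t \<partial>lborel)"
      by (rule integral_completion) simp
    finally show ?thesis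
      unfolding radon_fourier_def eq by simp
  qed
  have trunc: "inv_radon_trunc ?f R = fourier_partial V R" if "0 < R" for R
  proof
    fix q
    let ?F = "\<lambda>p. \<integral>x. cis (p \<bullet> x) * V x \<partial>lborel"
    let ?h = "\<lambda>p. cis (- (p \<bullet> q)) * ?F p"
    have h_int: "integrable lborel (\<lambda>p. indicator (ball 0 R) p *\<^sub>R ?h p)"
      by (rule integrable_bounded_on_ball[where C="\<integral>x. cmod (V x) \<partial>lborel"])
         (auto simp: norm_mult intro: fourier_bound[OF V1])
    have "(LINT \<theta>|sphere_measure. LINT s|lebesgue_on {0..R}.
        exp (- \<i> * complex_of_real (s * (\<theta> \<bullet> q))) * radon_fourier ?f s \<theta> * complex_of_real (s ^ (DIM('a) - 1)))
      = (LINT \<theta>|sphere_measure. complex_of_real (1 / (2 * pi)) * (LINT s|lebesgue_on {0..R}. ?h (s *\<^sub>R \<theta>) * complex_of_real (s ^ (DIM('a) - 1))))"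
    proof (rule Bochner_Integration.integral_cong[OF refl])
      fix \<theta> :: 'a assume "\<theta> \<in> space sphere_measure"
      then have \<theta>: "norm \<theta> = 1" by (simp add: space_sphere_measure)
      have cis: "exp (- \<i> * complex_of_real (s * (\<theta> \<bullet> q))) = cis (- ((s *\<^sub>R \<theta>) \<bullet> q))" for s
        by (simp add: cis_conv_exp)
      have "(LINT s|lebesgue_on {0..R}. exp (- \<i> * complex_of_real (s * (\<theta> \<bullet> q))) * radon_fourier ?f s \<theta> * complex_of_real (s ^ (DIM('a) - 1)))
        = (LINT s|lebesgue_on {0..R}. complex_of_real (1 / (2 * pi)) * (?h (s *\<^sub>R \<theta>) * complex_of_real (s ^ (DIM('a) - 1))))"
        by (intro Bochner_Integration.integral_cong refl) (simp only: cis radon_fourier[OF \<theta>] mult_ac)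
      then show "(LINT s|lebesgue_on {0..R}. exp (- \<i> * complex_of_real (s * (\<theta> \<bullet> q))) * radon_fourier ?f s \<theta> * complex_of_real (s ^ (DIM('a) - 1)))
        = complex_of_real (1 / (2 * pi)) * (LINT s|lebesgue_on {0..R}. ?h (s *\<^sub>R \<theta>) * complex_of_real (s ^ (DIM('a) - 1)))"
        by (simp only: integral_mult_right_zero)
    qed
    also have "\<dots> = complex_of_real (1 / (2 * pi)) * (\<integral>p. indicator (ball 0 R) p *\<^sub>R ?h p \<partial>lborel)"
      by (subst integral_polar[OF _ that h_int]) auto
    finally have "inv_radon_trunc ?f R q = complex_of_real (1 / (2 * pi) ^ (DIM('a) - 1)) *
        (complex_of_real (1 / (2 * pi)) * (\<integral>p. indicator (ball 0 R) p *\<^sub>R ?h p \<partial>lborel))"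
      unfolding inv_radon_trunc_def by simp
    also have "\<dots> = complex_of_real (1 / (2 * pi) ^ (DIM('a) - 1) * (1 / (2 * pi))) * (\<integral>p. indicator (ball 0 R) p *\<^sub>R ?h p \<partial>lborel)"
      by (simp only: of_real_mult mult.assoc)
    also have "1 / (2 * pi) ^ (DIM('a) - 1) * (1 / (2 * pi)) = 1 / (2 * pi) ^ DIM('a)"
      by (subst (2) power_eq_if) simp
    finally show "inv_radon_trunc ?f R q = fourier_partial V R q"
      unfolding fourier_partial_def .
  qed
  have L2_leb: "h \<in> L2 lebesgue" if "h \<in> borel_measurable borel" "integrable lborel (\<lambda>q. (cmod (h q))\<^sup>2)" for h :: "'a \<Rightarrow> complex"
    using that by (auto simp: L2_def integrable_completion intro: measurable_completion)
  have "L2_tendsto lebesgue (inv_radon_trunc ?f) V at_top"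
    unfolding L2_tendsto_def
  proof (intro conjI)
    show "V \<in> L2 lebesgue" by (rule L2_leb[OF V V2])
    show "\<forall>\<^sub>F R in at_top. inv_radon_trunc ?f R \<in> L2 lebesgue"
      using eventually_gt_at_top[of 0]
      by eventually_elim (simp add: trunc L2_leb fourier_partial_measurable[OF V V1 V2] fourier_partial_L2[OF V V1 V2])
    have "\<forall>\<^sub>F R in at_top. (LINT q|lebesgue. (cmod (inv_radon_trunc ?f R q - V q))\<^sup>2) = (\<integral>q. (cmod (fourier_partial V R q - V q))\<^sup>2 \<partial>lborel)"
      using eventually_gt_at_top[of 0]
    proof eventually_elim
      fix R :: real assume "0 < R"
      note [measurable] = fourier_partial_measurable[OF V V1 V2, of R]
      show "(LINT q|lebesgue. (cmod (inv_radon_trunc ?f R q - V q))\<^sup>2) = (\<integral>q. (cmod (fourier_partial V R q - V q))\<^sup>2 \<partial>lborel)"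
        unfolding trunc[OF \<open>0 < R\<close>] by (rule integral_completion) measurable
    qed
    then show "((\<lambda>R. LINT q|lebesgue. (cmod (inv_radon_trunc ?f R q - V q))\<^sup>2) \<longlongrightarrow> 0) at_top"
      using fourier_inversion_L2[OF V V1 V2] by (subst tendsto_cong)
  qed
  note radon = L2_lim_eq[OF this, folded inv_radon_def, simplified]
  have "AE q in lborel. inv_radon ?f (inverse \<sigma> *\<^sub>R q) = V (inverse \<sigma> *\<^sub>R q)"
    using radon(2) \<open>\<sigma> > 0\<close> by (intro AE_lborel_scaleR) (simp_all add: AE_completion_iff)
  with vV have "AE q in lborel. v q = inv_radon ?f (q /\<^sub>R \<sigma>)"
    by eventually_elim simp
  then have "AE q in lebesgue. v q = inv_radon ?f (q /\<^sub>R \<sigma>)"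
    by (simp only: AE_completion_iff)
  with prolate symmetric radon(1) show ?thesis
    by simp
qed

end
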